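(* Let $p>3$ be a prime and, for $n\ge0$, let $T_n=\sum_{k=0}^n\binom{n}{k}^2\binom{2k}{n}^2$. Then $$\sum_{k=0}^{p-1}(2k+1)\frac{T_k}{4^k}\equiv p+\frac76p^4B_{p-3}\pmod{p^5}$$ and $$\sum_{k=0}^{p-1}(2k+1)\frac{T_k}{(-4)^k}\equiv(-1)^{(p-1)/2}p+p^3E_{p-3}\pmod{p^4},$$ where $B_{p-3}$ is the $(p-3)$th Bernoulli number and $E_{p-3}$ is the $(p-3)$th Euler number.
   Context: The Bernoulli numbers $B_n$ are the standard ones, defined by $\frac{t}{e^t-1}=\sum_{n\ge0}B_n\frac{t^n}{n!}$. The Euler numbers $E_n$ are defined by $\frac{2e^t}{e^{2t}+1}=\sum_{n=0}^\infty E_n\frac{t^n}{n!}$ for $|t|<\pi/2$. A congruence $a\equiv b\pmod{p^m}$ between rational numbers whose denominators are coprime to $p$ means that $(a-b)/p^m$ is a rational number whose denominator is coprime to $p$. *)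

theory Defs
  imports "HOL-Computational_Algebra.Computational_Algebra"
begin

text \<open>
  Exponential generating function of the Bernoulli numbers. The denominator is not a unit; division of
  power series over a field cancels the common factor \<open>t\<close>, which
  \<open>fps_bernoulli_mult\<close> below confirms. The convention is $B_1 = -1/2$.
\<close>
definition fps_bernoulli :: "rat fps" where
  "fps_bernoulli = fps_X / (fps_exp 1 - 1)"

definition bernoulli_number :: "nat \<Rightarrow> rat" where
  "bernoulli_number n = fact n * fps_nth fps_bernoulli n"

definition fps_euler :: "rat fps" where
  "fps_euler = (2 * fps_exp 1) / (fps_exp 2 + 1)"

definition euler_number :: "nat \<Rightarrow> rat" where
  "euler_number n = fact n * fps_nth fps_euler n"

definition T :: "nat \<Rightarrow> nat" where
  "T n = (\<Sum>k=0..n. (n choose k)\<^sup>2 * ((2 * k) choose n)\<^sup>2)"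

text \<open>\<open>quotient_of\<close> yields the reduced fraction, with positive denominator.\<close>
definition denom_coprime :: "nat \<Rightarrow> rat \<Rightarrow> bool" where
  "denom_coprime p a \<longleftrightarrow> coprime (snd (quotient_of a)) (int p)"

text \<open>
  The congruence $a \equiv b \pmod{p^m}$ of rationals. It is only meaningful when the denominators of
  \<open>a\<close> and \<open>b\<close> are coprime to \<open>p\<close>, so this is part of what it asserts.
\<close>
definition rat_cong :: "nat \<Rightarrow> nat \<Rightarrow> rat \<Rightarrow> rat \<Rightarrow> bool" where
  "rat_cong p m a b \<longleftrightarrow>
     denom_coprime p a \<and> denom_coprime p b \<and> denom_coprime p ((a - b) / of_nat p ^ m)"

lemma fps_bernoulli_mult: "fps_bernoulli * (fps_exp 1 - 1) = fps_X"
proof -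
  have n: "(fps_exp 1 - 1 :: rat fps) $ 1 \<noteq> 0" by simp
  hence "subdegree (fps_exp 1 - 1 :: rat fps) \<le> 1" by (rule subdegree_leI)
  hence "(fps_exp 1 - 1 :: rat fps) dvd fps_X"
    using n by (subst fps_dvd_iff) (auto simp: fps_eq_iff)
  thus ?thesis unfolding fps_bernoulli_def by (rule dvd_div_mult_self)
qed

lemma fps_euler_mult: "fps_euler * (fps_exp 2 + 1) = 2 * fps_exp 1"
proof -
  have "(fps_exp 2 + 1 :: rat fps) dvd 1" by (simp add: fps_is_unit_iff)
  hence "(fps_exp 2 + 1 :: rat fps) dvd 2 * fps_exp 1" by (rule dvd_trans) simp
  thus ?thesis unfolding fps_euler_def by (rule dvd_div_mult_self)
qed

end

theory Submission
  imports Defs "HOL-Number_Theory.Residues"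
begin

text \<open>
  Write $w_j(n) = \binom nj \binom{n+j}j$ and $c_j = \binom{2j}j^2/16^j$. Both sides of
  $T_n/4^n = \sum_j c_j w_{2j}(n)$ satisfy the same three-term recurrence, by creative telescoping.
  The sums over $k$ of $(2k+1)w_{2j}(k)$ and of $(-1)^k(2k+1)w_{2j}(k)$ telescope, and with
  $p = 2m+1$ one has
  $$c_j \prod_{i\le 2j}(1-p^2/i^2) = (-1)^j w_j(m) \prod_{i\le j}(1-p^2/(4i^2)).$$
  Expanding the last product to order $p^2$ leaves sums over $j$ of $(-1)^j w_j(m)$, weighted by
  $1$ or by $H_j^{(2)}$, and divided by $2j+1$ in the first congruence. All four have closed forms;
  their differences in $m$ come from the same telescoping term. What remains is
  $p + \frac12 p^3 H_m^{(2)}$ and $(-1)^m (p + \frac12 p^3 \sum_{k\le m} (-1)^k/k^2)$.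
  Power sums reduce the alternating sum to $2(-1)^m E_{p-3}$ modulo $p$ and $H_m^{(3)}$ to
  $-2B_{p-3}$ modulo $p$; reflecting $i \mapsto p - i$ and separating even and odd $i$ gives
  $H_m^{(2)} \equiv -\frac76 p H_m^{(3)}$ modulo $p^2$.
\<close>

section \<open>A recurrence for $T_n$\<close>

text \<open>
  Vanishing at negative integers makes \<open>inv_fact_rec\<close> valid everywhere, so the telescoping needs no
  boundary cases.
\<close>
definition inv_fact :: "int \<Rightarrow> rat" where
  "inv_fact z = (if z < 0 then 0 else 1 / fact (nat z))"

lemma inv_fact_neg [simp]: "z < 0 \<Longrightarrow> inv_fact z = 0"
  by (simp add: inv_fact_def)

lemma inv_fact_nat: "inv_fact (int n) = 1 / fact n"
  by (simp add: inv_fact_def)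

lemma inv_fact_rec: "inv_fact (z - 1) = of_int z * inv_fact z"
proof (cases "z \<le> 0")
  case True
  then show ?thesis by (cases "z = 0") auto
next
  case False
  then obtain n where z: "z = int (Suc n)"
    by (metis not_le zero_less_imp_eq_int gr0_implies_Suc)
  have "z - 1 = int n" using z by simp
  then have "inv_fact (z - 1) = 1 / fact n" by (simp only: inv_fact_nat)
  then show ?thesis unfolding z inv_fact_nat by (simp add: fact_Suc del: of_nat_Suc)
qed

text \<open>The factor n! cancels in the product of the two binomials, leaving (2k)! / (k! (n-k)!
  (2k-n)!). In this form n occurs only inside \<open>inv_fact\<close>, so shifting n changes a
  summand by polynomial factors.\<close>

definition T_summand :: "nat \<Rightarrow> nat \<Rightarrow> rat" where
  "T_summand n k =
     (of_nat ((2 * k) choose k) * fact k * inv_fact (int n - int k) * inv_fact (2 * int k - int n))\<^sup>2"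

lemma T_summand_binomial:
  assumes "k \<le> n"
  shows "T_summand n k = of_nat ((n choose k)\<^sup>2 * ((2 * k) choose n)\<^sup>2)"
proof (cases "n \<le> 2 * k")
  case True
  have 1: "int n - int k = int (n - k)" "2 * int k - int n = int (2 * k - n)"
    using assms True by auto
  have b: "rat_of_nat ((2 * k) choose k) = fact (2 * k) / (fact k * fact k)"
    using binomial_fact[of k "2 * k", where 'a = rat] by (simp add: mult_2)
  have "of_nat ((2 * k) choose k) * fact k * inv_fact (int n - int k) * inv_fact (2 * int k - int n)
      = rat_of_nat ((n choose k) * ((2 * k) choose n))"
    unfolding 1 inv_fact_nat b of_nat_mult binomial_fact[OF assms] binomial_fact[OF True]
    by simp
  then show ?thesis by (simp add: T_summand_def power_mult_distrib)
qed (simp add: T_summand_def)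

lemma T_summand_eq_0: "n < k \<Longrightarrow> T_summand n k = 0"
  by (simp add: T_summand_def)

lemma T_eq_sum:
  assumes "n \<le> N"
  shows "of_nat (T n) = (\<Sum>k\<le>N. T_summand n k)"
proof -
  have "of_nat (T n) = (\<Sum>k\<le>n. T_summand n k)"
    unfolding T_def of_nat_sum atMost_atLeast0 by (rule sum.cong) (simp_all add: T_summand_binomial)
  also have "\<dots> = (\<Sum>k\<le>N. T_summand n k)"
    by (rule sum.mono_neutral_left) (use assms in \<open>auto simp: T_summand_eq_0\<close>)
  finally show ?thesis .
qed

text \<open>The certificate of creative telescoping for the recurrence of $T_n$.\<close>
definition T_cert :: "nat \<Rightarrow> nat \<Rightarrow> rat" where
  "T_cert n k = (of_nat ((2 * k) choose k) * fact k
       * inv_fact (int n + 1 - int k) * inv_fact (2 * int k - int n - 1))\<^sup>2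
     * (4 * (2 * of_nat n + 1) * (of_nat k - of_nat n - 1)\<^sup>2 - (of_nat n + 1) ^ 3)"

lemma central_binomial_Suc:
  "of_nat ((2 * Suc k) choose Suc k) * fact (Suc k)
     = 2 * (2 * of_nat k + 1) * (of_nat ((2 * k) choose k) * fact k :: rat)"
proof -
  have b: "rat_of_nat ((2 * k) choose k) = fact (2 * k) / (fact k * fact k)" for k
    using binomial_fact[of k "2 * k", where 'a = rat] by (simp add: mult_2)
  have "fact (2 * Suc k) = 2 * (2 * of_nat k + 1) * (of_nat k + 1) * (fact (2 * k) :: rat)"
    by (simp add: algebra_simps)
  moreover have "(of_nat k + 1 :: rat) \<noteq> 0" using of_nat_neq_0[of k, where 'a = rat] by (simp add: add.commute)
  ultimately show ?thesis unfolding b fact_Suc[of k] of_nat_Suc by (simp add: divide_simps)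
qed

text \<open>Here \<open>a\<close> and \<open>b\<close> are the inverse factorials with the largest
  arguments that occur. By \<open>inv_fact_rec\<close> every term becomes a polynomial in n and k
  times the square of \<open>A * a * b\<close>, which leaves a polynomial identity.\<close>

lemma T_summand_telescope:
  "(of_nat n + 2) ^ 3 * T_summand (Suc (Suc n)) k
     - (2 * of_nat n + 3) * (12 * (of_nat n + 1)\<^sup>2 + 12 * (of_nat n + 1) + 4) * T_summand (Suc n) k
     + 16 * (of_nat n + 1) ^ 3 * T_summand n k
   = T_cert (Suc n) (Suc k) - T_cert (Suc n) k"
proof -
  define A where "A = rat_of_nat ((2 * k) choose k) * fact k"
  define N where "N = rat_of_nat n"
  define K where "K = rat_of_nat k"
  define a where "a = inv_fact (int n + 2 - int k)"
  define b where "b = inv_fact (2 * int k - int n)"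
  have a1: "inv_fact (int n + 1 - int k) = (N + 2 - K) * a"
    using inv_fact_rec[of "int n + 2 - int k"] by (simp add: a_def N_def K_def algebra_simps)
  have a2: "inv_fact (int n - int k) = (N + 1 - K) * ((N + 2 - K) * a)"
    using inv_fact_rec[of "int n + 1 - int k"] unfolding a1[symmetric]
    by (simp add: N_def K_def algebra_simps)
  have b1: "inv_fact (2 * int k - int n - 1) = (2 * K - N) * b"
    using inv_fact_rec[of "2 * int k - int n"] by (simp add: b_def N_def K_def algebra_simps)
  have b2: "inv_fact (2 * int k - int n - 2) = (2 * K - N - 1) * ((2 * K - N) * b)"
    using inv_fact_rec[of "2 * int k - int n - 1"] unfolding b1[symmetric]
    by (simp add: N_def K_def algebra_simps)
  have A: "rat_of_nat ((2 * Suc k) choose Suc k) * fact (Suc k) = 2 * (2 * K + 1) * A"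
    unfolding A_def K_def by (rule central_binomial_Suc)
  have T0: "T_summand n k = (A * ((N + 1 - K) * ((N + 2 - K) * a)) * b)\<^sup>2"
    unfolding T_summand_def a2 b_def A_def ..
  have T1: "T_summand (Suc n) k = (A * ((N + 2 - K) * a) * ((2 * K - N) * b))\<^sup>2"
    unfolding T_summand_def a1[symmetric] b1[symmetric] A_def by (simp add: algebra_simps)
  have T2: "T_summand (Suc (Suc n)) k = (A * a * ((2 * K - N - 1) * ((2 * K - N) * b)))\<^sup>2"
    unfolding T_summand_def a_def b2[symmetric] A_def by (simp add: algebra_simps)
  have C0: "T_cert (Suc n) k = (A * a * ((2 * K - N - 1) * ((2 * K - N) * b)))\<^sup>2
      * (4 * (2 * N + 3) * (K - N - 2)\<^sup>2 - (N + 2) ^ 3)"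
    unfolding T_cert_def a_def b2[symmetric] A_def by (simp add: algebra_simps N_def K_def)
  have C1: "T_cert (Suc n) (Suc k) = (2 * (2 * K + 1) * A * ((N + 2 - K) * a) * b)\<^sup>2
      * (4 * (2 * N + 3) * (K - N - 1)\<^sup>2 - (N + 2) ^ 3)"
    unfolding T_cert_def A a1[symmetric] b_def by (simp add: algebra_simps N_def K_def)
  show ?thesis
    unfolding T0 T1 T2 C0 C1 N_def[symmetric] by Groebner_Basis.algebra
qed

lemma T_recurrence:
  "(of_nat n + 2) ^ 3 * rat_of_nat (T (Suc (Suc n)))
     - (2 * of_nat n + 3) * (12 * (of_nat n + 1)\<^sup>2 + 12 * (of_nat n + 1) + 4) * of_nat (T (Suc n))
     + 16 * (of_nat n + 1) ^ 3 * of_nat (T n) = 0"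
proof -
  have "(\<Sum>k\<le>n + 2. T_cert (Suc n) (Suc k) - T_cert (Suc n) k)
      = T_cert (Suc n) (Suc (n + 2)) - T_cert (Suc n) 0"
    unfolding lessThan_Suc_atMost[symmetric] by (rule sum_lessThan_telescope)
  \<comment> \<open>At each end some argument of \<open>inv_fact\<close> is negative: it is -1 at
    the top index n+3 and -n-2 at the bottom index 0.\<close>
  also have "\<dots> = 0" by (simp add: T_cert_def)
  finally have tele: "(\<Sum>k\<le>n + 2. T_cert (Suc n) (Suc k) - T_cert (Suc n) k) = 0" .
  have T: "rat_of_nat (T n) = (\<Sum>k\<le>n + 2. T_summand n k)"
    "rat_of_nat (T (Suc n)) = (\<Sum>k\<le>n + 2. T_summand (Suc n) k)"
    "rat_of_nat (T (Suc (Suc n))) = (\<Sum>k\<le>n + 2. T_summand (Suc (Suc n)) k)"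
    by (rule T_eq_sum, simp)+
  show ?thesis
    using tele unfolding T T_summand_telescope[symmetric]
    by (simp only: sum.distrib sum_subtractf sum_distrib_left)
qed

section \<open>Expansion of $T_n$ in products of binomial coefficients\<close>

text \<open>
  For natural $n$, \<open>legendre_coeff n j\<close> is $\binom nj \binom{n+j}j$; \<open>square_coeff x j\<close> is
  $(-1)^j \prod_{i=1}^j (1-x^2/i^2)$ and \<open>central_ratio j\<close> is $\binom{2j}j^2/16^j$.
\<close>
definition legendre_coeff :: "rat \<Rightarrow> nat \<Rightarrow> rat" where
  "legendre_coeff x j = (\<Prod>i<j. (x * (x + 1) - of_nat i * (of_nat i + 1)) / (of_nat i + 1)\<^sup>2)"

definition square_coeff :: "rat \<Rightarrow> nat \<Rightarrow> rat" where
  "square_coeff x j = (\<Prod>i<j. (x\<^sup>2 - (of_nat i + 1)\<^sup>2) / (of_nat i + 1)\<^sup>2)"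

definition central_ratio :: "nat \<Rightarrow> rat" where
  "central_ratio j = (\<Prod>i<j. (2 * of_nat i + 1)\<^sup>2 / (2 * of_nat i + 2)\<^sup>2)"

lemma legendre_coeff_0 [simp]: "legendre_coeff x 0 = 1"
  by (simp add: legendre_coeff_def)

lemma legendre_coeff_Suc:
  "legendre_coeff x (Suc j)
     = legendre_coeff x j * ((x * (x + 1) - of_nat j * (of_nat j + 1)) / (of_nat j + 1)\<^sup>2)"
  by (simp add: legendre_coeff_def)

lemma square_coeff_0 [simp]: "square_coeff x 0 = 1"
  by (simp add: square_coeff_def)

lemma square_coeff_Suc:
  "square_coeff x (Suc j) = square_coeff x j * ((x\<^sup>2 - (of_nat j + 1)\<^sup>2) / (of_nat j + 1)\<^sup>2)"
  by (simp add: square_coeff_def)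

lemma central_ratio_0 [simp]: "central_ratio 0 = 1"
  by (simp add: central_ratio_def)

lemma central_ratio_Suc:
  "central_ratio (Suc j) = central_ratio j * ((2 * of_nat j + 1)\<^sup>2 / (2 * of_nat j + 2)\<^sup>2)"
  by (simp add: central_ratio_def)

lemma of_nat_add_1_neq_0: "(of_nat j + 1 :: rat) \<noteq> 0"
  using of_nat_neq_0[of j, where 'a = rat] by (simp add: add.commute)

lemma legendre_coeff_eq_0:
  assumes "n < j"
  shows "legendre_coeff (of_nat n) j = 0"
  unfolding legendre_coeff_def using assms by (auto intro!: bexI[of _ n])

text \<open>The numerators split as x(x+1) - i(i+1) = (x-i)(x+i+1) and x^2 - (i+1)^2 =
  (x-i-1)(x+i+1). The second factors agree and the first are shifted by one index, so only the end
  factors x and x-j survive. Together with the companion at x+1 this drives the telescoping over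
  n.\<close>

lemma square_coeff_eq_legendre: "x * square_coeff x j = (x - of_nat j) * legendre_coeff x j"
proof (induction j)
  case (Suc j)
  have "x * square_coeff x (Suc j)
      = (x * square_coeff x j) * ((x\<^sup>2 - (of_nat j + 1)\<^sup>2) / (of_nat j + 1)\<^sup>2)"
    by (simp add: square_coeff_Suc)
  also have "\<dots> = (x - of_nat (Suc j)) * legendre_coeff x (Suc j)"
    unfolding Suc.IH legendre_coeff_Suc using of_nat_add_1_neq_0[of j]
    by (simp add: divide_simps) Groebner_Basis.algebra
  finally show ?case .
qed simp

lemma square_coeff_eq_legendre_pred:
  "(x + 1) * square_coeff (x + 1) j = (x + 1 + of_nat j) * legendre_coeff x j"
proof (induction j)
  case (Suc j)
  have "(x + 1) * square_coeff (x + 1) (Suc j)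
      = ((x + 1) * square_coeff (x + 1) j) * (((x + 1)\<^sup>2 - (of_nat j + 1)\<^sup>2) / (of_nat j + 1)\<^sup>2)"
    by (simp add: square_coeff_Suc)
  also have "\<dots> = (x + 1 + of_nat (Suc j)) * legendre_coeff x (Suc j)"
    unfolding Suc.IH legendre_coeff_Suc using of_nat_add_1_neq_0[of j]
    by (simp add: divide_simps) Groebner_Basis.algebra
  finally show ?case .
qed simp

lemma legendre_coeff_shift:
  "legendre_coeff (x + 1) (Suc j)
     = (x + of_nat j + 1) * (x + of_nat j + 2) / (of_nat j + 1)\<^sup>2 * legendre_coeff x j"
proof (induction j)
  case 0
  then show ?case by (simp add: legendre_coeff_Suc algebra_simps)
next
  case (Suc j)
  have nz: "(of_nat j + 2 :: rat) \<noteq> 0" using of_nat_add_1_neq_0[of "Suc j"] by (simp add: add.commute)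
  have "legendre_coeff (x + 1) (Suc (Suc j)) = legendre_coeff (x + 1) (Suc j)
      * (((x + 1) * (x + 2) - (of_nat j + 1) * (of_nat j + 2)) / (of_nat j + 2)\<^sup>2)"
    by (subst legendre_coeff_Suc) (simp add: algebra_simps)
  also have "\<dots> = (x + of_nat (Suc j) + 1) * (x + of_nat (Suc j) + 2) / (of_nat (Suc j) + 1)\<^sup>2
      * legendre_coeff x (Suc j)"
    unfolding Suc.IH legendre_coeff_Suc[of x j] using of_nat_add_1_neq_0[of j] nz
    by (simp add: divide_simps) Groebner_Basis.algebra
  finally show ?case .
qed

text \<open>The coefficient depends on x only through x(x+1), which the reflection fixes. It turns
  the upward shift of x into the downward one.\<close>

lemma legendre_coeff_reflect: "legendre_coeff (- 1 - x) j = legendre_coeff x j"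
  by (simp add: legendre_coeff_def algebra_simps)

lemma legendre_coeff_shift_down:
  "legendre_coeff (x - 1) (Suc j)
     = (x - of_nat j) * (x - of_nat j - 1) / (of_nat j + 1)\<^sup>2 * legendre_coeff x j"
  using legendre_coeff_shift[of "- 1 - x" j] legendre_coeff_reflect[of x j]
    legendre_coeff_reflect[of "x - 1" "Suc j"]
  by (simp add: algebra_simps)

text \<open>The terms added at index 2J+2 are all rational multiples of
  \<open>legendre_coeff x (2 * J + 1)\<close>, so the induction step is an identity of rational
  functions. The closed form vanishes when x is a natural number below 2J+1, which yields the
  recurrence.\<close>

lemma legendre_coeff_sum_telescope:
  "(\<Sum>j\<le>J. central_ratio j * ((x + 1) ^ 3 * legendre_coeff (x + 1) (2 * j)
       - (2 * x + 1) * (3 * x\<^sup>2 + 3 * x + 1) * legendre_coeff x (2 * j)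
       + x ^ 3 * legendre_coeff (x - 1) (2 * j)))
   = - 2 * (2 * x + 1) * (2 * of_nat J + 1)\<^sup>2 * legendre_coeff x (2 * J + 1) * central_ratio J"
proof (induction J)
  case 0
  show ?case by (simp add: legendre_coeff_Suc) Groebner_Basis.algebra
next
  case (Suc J)
  define K where "K = rat_of_nat J"
  define y where "y = legendre_coeff x (2 * J + 1)"
  have nz: "2 * K + 2 \<noteq> 0" "2 * K + 3 \<noteq> 0"
    using of_nat_add_1_neq_0[of "2 * J + 1"] of_nat_add_1_neq_0[of "2 * J + 2"]
    by (simp_all add: K_def add.commute)
  have w1: "legendre_coeff (x + 1) (2 * Suc J)
      = (x + 2 * K + 2) * (x + 2 * K + 3) / (2 * K + 2)\<^sup>2 * y"
    using legendre_coeff_shift[of x "2 * J + 1"] by (simp add: y_def K_def algebra_simps)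
  have w2: "legendre_coeff (x - 1) (2 * Suc J)
      = (x - 2 * K - 1) * (x - 2 * K - 2) / (2 * K + 2)\<^sup>2 * y"
    using legendre_coeff_shift_down[of x "2 * J + 1"] by (simp add: y_def K_def algebra_simps)
  have w0: "legendre_coeff x (2 * Suc J)
      = (x * (x + 1) - (2 * K + 1) * (2 * K + 2)) / (2 * K + 2)\<^sup>2 * y"
    using legendre_coeff_Suc[of x "2 * J + 1"] by (simp add: y_def K_def algebra_simps)
  have w3: "legendre_coeff x (2 * Suc J + 1)
      = (x * (x + 1) - (2 * K + 2) * (2 * K + 3)) / (2 * K + 3)\<^sup>2 * legendre_coeff x (2 * Suc J)"
    using legendre_coeff_Suc[of x "2 * Suc J"] by (simp add: K_def algebra_simps)
  have c: "central_ratio (Suc J) = central_ratio J * ((2 * K + 1)\<^sup>2 / (2 * K + 2)\<^sup>2)"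
    by (simp add: central_ratio_Suc K_def)
  have k: "2 * rat_of_nat (Suc J) + 1 = 2 * K + 3" by (simp add: K_def)
  show ?case
    unfolding sum.atMost_Suc Suc.IH k w3 w0 w1 w2 c y_def[symmetric] K_def[symmetric] using nz
    by (simp add: divide_simps) Groebner_Basis.algebra
qed

section \<open>The sum over j and its three-term recurrence\<close>

definition legendre_sum :: "nat \<Rightarrow> rat" where
  "legendre_sum n = (\<Sum>j\<le>n. central_ratio j * legendre_coeff (of_nat n) (2 * j))"

text \<open>Terms with 2j > n vanish, so the cutoff is flexible. This gives three consecutive n a
  common range, and later all indices below p the single range j \<le> m.\<close>

lemma legendre_sum_eq:
  assumes "n \<le> 2 * J + 1"
  shows "legendre_sum n = (\<Sum>j\<le>J. central_ratio j * legendre_coeff (of_nat n) (2 * j))"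
proof (cases "n \<le> J")
  case True
  then show ?thesis unfolding legendre_sum_def
    by (intro sum.mono_neutral_left) (auto simp: legendre_coeff_eq_0)
next
  case False
  then show ?thesis unfolding legendre_sum_def using assms
    by (intro sum.mono_neutral_right) (auto simp: legendre_coeff_eq_0)
qed

lemma legendre_sum_recurrence:
  "(of_nat n + 2) ^ 3 * legendre_sum (Suc (Suc n))
     - (2 * of_nat n + 3) * (3 * (of_nat n + 1)\<^sup>2 + 3 * (of_nat n + 1) + 1) * legendre_sum (Suc n)
     + (of_nat n + 1) ^ 3 * legendre_sum n = 0"
proof -
  have "(\<Sum>j\<le>n+2. central_ratio j
       * ((of_nat (Suc n) + 1) ^ 3 * legendre_coeff (of_nat (Suc n) + 1) (2 * j)
       - (2 * of_nat (Suc n) + 1) * (3 * (of_nat (Suc n))\<^sup>2 + 3 * of_nat (Suc n) + 1)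
           * legendre_coeff (of_nat (Suc n)) (2 * j)
       + of_nat (Suc n) ^ 3 * legendre_coeff (of_nat (Suc n) - 1) (2 * j))) = 0"
    unfolding legendre_coeff_sum_telescope by (subst legendre_coeff_eq_0) auto
  moreover have "rat_of_nat (Suc n) + 1 = of_nat (Suc (Suc n))" "rat_of_nat (Suc n) - 1 = of_nat n"
    by simp_all
  ultimately have "(\<Sum>j\<le>n+2. of_nat (Suc (Suc n)) ^ 3 * (central_ratio j * legendre_coeff (of_nat (Suc (Suc n))) (2 * j))
       - (2 * of_nat (Suc n) + 1) * (3 * (of_nat (Suc n))\<^sup>2 + 3 * of_nat (Suc n) + 1)
           * (central_ratio j * legendre_coeff (of_nat (Suc n)) (2 * j))
       + of_nat (Suc n) ^ 3 * (central_ratio j * legendre_coeff (of_nat n) (2 * j))) = 0"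
    by (simp only: algebra_simps)
  moreover have "legendre_sum n = (\<Sum>j\<le>n + 2. central_ratio j * legendre_coeff (of_nat n) (2 * j))"
    "legendre_sum (Suc n) = (\<Sum>j\<le>n + 2. central_ratio j * legendre_coeff (of_nat (Suc n)) (2 * j))"
    "legendre_sum (Suc (Suc n))
       = (\<Sum>j\<le>n + 2. central_ratio j * legendre_coeff (of_nat (Suc (Suc n))) (2 * j))"
    by (rule legendre_sum_eq, simp)+
  ultimately have "of_nat (Suc (Suc n)) ^ 3 * legendre_sum (Suc (Suc n))
       - (2 * of_nat (Suc n) + 1) * (3 * (of_nat (Suc n))\<^sup>2 + 3 * of_nat (Suc n) + 1)
           * legendre_sum (Suc n)
       + of_nat (Suc n) ^ 3 * legendre_sum n = 0"
    by (simp only: sum.distrib sum_subtractf sum_distrib_left[symmetric])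
  then show ?thesis by (simp add: algebra_simps)
qed

lemma T_eq_legendre_sum: "of_nat (T n) = 4 ^ n * legendre_sum n"
proof (induction n rule: less_induct)
  case (less n)
  consider "n = 0" | "n = 1" | k where "n = Suc (Suc k)"
    by (metis One_nat_def not0_implies_Suc)
  then show ?case
  proof cases
    case 1
    then show ?thesis by (simp add: T_def legendre_sum_def)
  next
    case 2
    then show ?thesis using legendre_coeff_eq_0[of 1 2] by (simp add: T_def legendre_sum_def)
  next
    case (3 k)
    have IH: "rat_of_nat (T k) = 4 ^ k * legendre_sum k"
      "rat_of_nat (T (Suc k)) = 4 * 4 ^ k * legendre_sum (Suc k)"
      using less.IH[of k] less.IH[of "Suc k"] 3 by simp_all
    have nz: "(of_nat k + 2 :: rat) \<noteq> 0"
      using of_nat_add_1_neq_0[of "Suc k"] by (simp add: add.commute)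
    define e where "e = (4 :: rat) ^ k"
    \<comment> \<open>This is the recurrence of \<open>T\<close> minus 16 * 4^k times that of
      \<open>legendre_sum\<close>; the lower terms cancel by the induction hypothesis.\<close>
    have "(of_nat k + 2) ^ 3 * (rat_of_nat (T (Suc (Suc k))) - 16 * e * legendre_sum (Suc (Suc k))) = 0"
      using T_recurrence[of k] legendre_sum_recurrence[of k] unfolding IH e_def[symmetric] by Groebner_Basis.algebra
    hence "rat_of_nat (T (Suc (Suc k))) = 16 * 4 ^ k * legendre_sum (Suc (Suc k))"
      using nz by (simp add: e_def)
    then show ?thesis unfolding 3 by simp
  qed
qed

text \<open>By the two relations with \<open>square_coeff\<close>, the right side grows from N to
  N+1 by ((N+1)(N+1+j) - N(N-j)) times \<open>legendre_coeff (of_nat N) j\<close>, and the bracket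
  factors as (j+1)(2N+1).\<close>

lemma sum_odd_legendre_coeff:
  "(of_nat j + 1) * (\<Sum>n<N. (2 * of_nat n + 1) * legendre_coeff (of_nat n) j)
     = of_nat N ^ 2 * square_coeff (of_nat N) j"
proof (induction N)
  case (Suc N)
  have "(of_nat j + 1) * (\<Sum>n<Suc N. (2 * of_nat n + 1) * legendre_coeff (of_nat n) j)
      = of_nat N ^ 2 * square_coeff (of_nat N) j
        + (of_nat j + 1) * (2 * of_nat N + 1) * legendre_coeff (of_nat N) j"
    using Suc.IH by (simp add: algebra_simps)
  also have "\<dots> = of_nat (Suc N) ^ 2 * square_coeff (of_nat (Suc N)) j"
    using square_coeff_eq_legendre[of "of_nat N" j] square_coeff_eq_legendre_pred[of "of_nat N" j]
    unfolding of_nat_Suc add.commute[of 1] by Groebner_Basis.algebra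
  finally show ?case .
qed simp

text \<open>The alternating sign adds the two relations instead of subtracting them: (N+1+j) + (N-j)
  = 2N+1, so no factor j+1 appears.\<close>

lemma alternating_sum_odd_legendre_coeff:
  "(\<Sum>n<N. (- 1) ^ n * (2 * of_nat n + 1) * legendre_coeff (of_nat n) j)
     = - ((- 1) ^ N * of_nat N * square_coeff (of_nat N) j)"
proof (induction N)
  case (Suc N)
  define e where "e = (- 1 :: rat) ^ N"
  show ?case
    using square_coeff_eq_legendre[of "of_nat N" j] square_coeff_eq_legendre_pred[of "of_nat N" j]
    unfolding of_nat_Suc add.commute[of 1] sum.lessThan_Suc Suc.IH power_Suc e_def[symmetric]
    by Groebner_Basis.algebra
qed simp

section \<open>Weighted sums of Legendre coefficients\<close>

definition harmonic2 :: "nat \<Rightarrow> rat" where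
  "harmonic2 n = (\<Sum>i<n. 1 / (of_nat i + 1)\<^sup>2)"

lemma harmonic2_0 [simp]: "harmonic2 0 = 0"
  by (simp add: harmonic2_def)

lemma harmonic2_Suc: "harmonic2 (Suc n) = harmonic2 n + 1 / (of_nat n + 1)\<^sup>2"
  by (simp add: harmonic2_def)

text \<open>
  The common factor of the coefficients at \<open>m\<close> and \<open>m + 1\<close>. It is $w_j(m)/(m+1-j)$, written so that it
  stays meaningful at \<open>j = m + 1\<close>.
\<close>
definition legendre_diff :: "nat \<Rightarrow> nat \<Rightarrow> rat" where
  "legendre_diff m j = legendre_coeff (of_nat m + 1) j / (of_nat m + 1 + of_nat j)"

lemma of_nat_add_add_1_neq_0: "(of_nat m + 1 + of_nat j :: rat) \<noteq> 0"
  using of_nat_add_1_neq_0[of "m + j"] by (simp add: ac_simps)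

lemma legendre_coeff_Suc_diff:
  "legendre_coeff (of_nat m + 1) j = (of_nat m + 1 + of_nat j) * legendre_diff m j"
  using of_nat_add_add_1_neq_0[of m j] by (simp add: legendre_diff_def)

lemma legendre_diff_Suc:
  "(of_nat j + 1)\<^sup>2 * legendre_diff m (Suc j)
     = (of_nat m + 1 + of_nat j) * (of_nat m + 1 - of_nat j) * legendre_diff m j"
proof -
  \<comment> \<open>The extra factor m+2+j turns \<open>legendre_diff m (Suc j)\<close> into a
    Legendre coefficient at m+1; it is cancelled at the end.\<close>
  have "(of_nat m + 1 + of_nat j + 1) * ((of_nat j + 1)\<^sup>2 * legendre_diff m (Suc j))
      = (of_nat j + 1)\<^sup>2 * legendre_coeff (of_nat m + 1) (Suc j)"
    by (subst legendre_coeff_Suc_diff) (simp add: algebra_simps)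
  also have "\<dots> = ((of_nat m + 1) * (of_nat m + 2) - of_nat j * (of_nat j + 1))
      * ((of_nat m + 1 + of_nat j) * legendre_diff m j)"
    unfolding legendre_coeff_Suc legendre_coeff_Suc_diff using of_nat_add_1_neq_0[of j]
    by simp
  also have "\<dots> = (of_nat m + 1 + of_nat j + 1)
      * ((of_nat m + 1 + of_nat j) * (of_nat m + 1 - of_nat j) * legendre_diff m j)"
    by Groebner_Basis.algebra
  finally have "(of_nat m + 1 + of_nat j + 1) * ((of_nat j + 1)\<^sup>2 * legendre_diff m (Suc j))
      = (of_nat m + 1 + of_nat j + 1)
        * ((of_nat m + 1 + of_nat j) * (of_nat m + 1 - of_nat j) * legendre_diff m j)" .
  moreover have "(of_nat m + 1 + of_nat j + 1 :: rat) \<noteq> 0"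
    using of_nat_add_1_neq_0[of "m + 1 + j"] by simp
  ultimately show ?thesis by (metis mult_left_cancel)
qed

lemma legendre_coeff_diff:
  "legendre_coeff (of_nat m) j = (of_nat m + 1 - of_nat j) * legendre_diff m j"
proof -
  have "(of_nat m + 1) * square_coeff (of_nat m + 1) j
      = (of_nat m + 1 - of_nat j) * ((of_nat m + 1 + of_nat j) * legendre_diff m j)"
    unfolding legendre_coeff_Suc_diff[symmetric] by (rule square_coeff_eq_legendre)
  then have "(of_nat m + 1 + of_nat j) * legendre_coeff (of_nat m) j
      = (of_nat m + 1 + of_nat j) * ((of_nat m + 1 - of_nat j) * legendre_diff m j)"
    unfolding square_coeff_eq_legendre_pred by (simp add: ac_simps)
  then show ?thesis using of_nat_add_add_1_neq_0[of m j] by simp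
qed

lemma legendre_diff_eq_0: "m + 1 < j \<Longrightarrow> legendre_diff m j = 0"
  using legendre_coeff_eq_0[of "m + 1" j] by (simp add: legendre_diff_def add.commute)

text \<open>Writing d_j for \<open>legendre_diff m j\<close>, the recursion reads (m+1)^2 d_j =
  (j+1)^2 d_(j+1) + j^2 d_j, so the alternating sum telescopes.\<close>

lemma sum_legendre_diff_partial:
  "(of_nat m + 1)\<^sup>2 * (\<Sum>j\<le>J. (- 1) ^ j * legendre_diff m j)
     = (- 1) ^ J * ((of_nat J + 1)\<^sup>2 * legendre_diff m (Suc J))"
proof (induction J)
  case 0
  then show ?case using legendre_diff_Suc[of 0 m] by (simp add: power2_eq_square)
next
  case (Suc J)
  define e where "e = (- 1 :: rat) ^ J"
  show ?case
    using Suc.IH legendre_diff_Suc[of "Suc J" m]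
    unfolding of_nat_Suc add.commute[of 1] sum.atMost_Suc power_Suc e_def[symmetric] by Groebner_Basis.algebra
qed

text \<open>Summation by parts against the preceding telescoping: the increment 1/(j+1)^2 of
  \<open>harmonic2\<close> cancels the factor (j+1)^2 and leaves the unweighted shifted sum.\<close>

lemma sum_legendre_diff_harmonic2_partial:
  "(of_nat m + 1)\<^sup>2 * (\<Sum>j\<le>J. (- 1) ^ j * legendre_diff m j * harmonic2 j)
     = (- 1) ^ J * ((of_nat J + 1)\<^sup>2 * legendre_diff m (Suc J)) * harmonic2 (Suc J)
       - (\<Sum>j\<le>J. (- 1) ^ j * legendre_diff m (Suc j))"
proof (induction J)
  case 0
  then show ?case by (simp add: harmonic2_Suc)
next
  case (Suc J)
  define e where "e = (- 1 :: rat) ^ J"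
  define h where "h = 1 / (rat_of_nat (Suc J) + 1)\<^sup>2"
  have h: "h * (rat_of_nat J + 1 + 1)\<^sup>2 = 1"
    using of_nat_add_1_neq_0[of "Suc J"] by (simp add: h_def add.commute)
  have H: "harmonic2 (Suc (Suc J)) = harmonic2 (Suc J) + h"
    by (simp only: harmonic2_Suc[of "Suc J"] h_def)
  show ?case
    using Suc.IH legendre_diff_Suc[of "Suc J" m] h
    unfolding H of_nat_Suc add.commute[of 1] sum.atMost_Suc power_Suc e_def[symmetric] by Groebner_Basis.algebra
qed

lemma sum_legendre_diff: "(\<Sum>j\<le>Suc m. (- 1) ^ j * legendre_diff m j) = 0"
  using sum_legendre_diff_partial[of m "Suc m"] of_nat_add_1_neq_0[of m]
  by (simp add: legendre_diff_eq_0 del: sum.atMost_Suc)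

lemma sum_legendre_diff_harmonic2:
  "(of_nat m + 1) ^ 3 * (\<Sum>j\<le>Suc m. (- 1) ^ j * legendre_diff m j * harmonic2 j) = - 1"
proof -
  \<comment> \<open>The range is extended by a zero term so that shifting the index isolates
    \<open>legendre_diff m 0\<close>, which is 1/(m+1).\<close>
  have "0 = (\<Sum>j\<le>Suc (Suc m). (- 1) ^ j * legendre_diff m j)"
    unfolding sum.atMost_Suc[of _ "Suc m"] using sum_legendre_diff[of m]
    by (simp add: legendre_diff_eq_0 del: sum.atMost_Suc)
  also have "\<dots> = legendre_diff m 0 - (\<Sum>j\<le>Suc m. (- 1) ^ j * legendre_diff m (Suc j))"
    by (subst sum.atMost_Suc_shift) (simp add: sum_negf del: sum.atMost_Suc)
  finally have "(\<Sum>j\<le>Suc m. (- 1) ^ j * legendre_diff m (Suc j)) = 1 / (of_nat m + 1)"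
    by (simp add: legendre_diff_def)
  hence "(of_nat m + 1)\<^sup>2 * (\<Sum>j\<le>Suc m. (- 1) ^ j * legendre_diff m j * harmonic2 j)
      = - 1 / (of_nat m + 1)"
    unfolding sum_legendre_diff_harmonic2_partial by (simp add: legendre_diff_eq_0 del: sum.atMost_Suc)
  then have "(of_nat m + 1) * ((of_nat m + 1)\<^sup>2 * (\<Sum>j\<le>Suc m. (- 1) ^ j * legendre_diff m j * harmonic2 j))
      = - 1"
    using of_nat_add_1_neq_0[of m] by (simp del: sum.atMost_Suc)
  then show ?thesis by (simp only: power3_eq_cube power2_eq_square mult.assoc)
qed

section \<open>Closed forms of the four weighted sums, by induction on m\<close>

lemma sum_legendre_coeff_extend:
  "(\<Sum>j\<le>m. (- 1) ^ j * legendre_coeff (of_nat m) j * f j)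
     = (\<Sum>j\<le>Suc m. (- 1) ^ j * legendre_coeff (of_nat m) j * f j)"
  by (simp add: legendre_coeff_eq_0)

text \<open>Adding consecutive sums works because (m+1+j) + (m+1-j) does not depend on j.\<close>

lemma sum_legendre_coeff_Suc_add:
  "(\<Sum>j\<le>Suc m. (- 1) ^ j * legendre_coeff (of_nat (Suc m)) j * f j)
     + (\<Sum>j\<le>m. (- 1) ^ j * legendre_coeff (of_nat m) j * f j)
   = 2 * (of_nat m + 1) * (\<Sum>j\<le>Suc m. (- 1) ^ j * legendre_diff m j * f j)"
  unfolding sum_legendre_coeff_extend[of m] sum.distrib[symmetric] sum_distrib_left
proof (rule sum.cong)
  fix j
  have w: "legendre_coeff (of_nat (Suc m)) j = (of_nat m + 1 + of_nat j) * legendre_diff m j"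
    using legendre_coeff_Suc_diff[of m j] by (simp add: add.commute)
  show "(- 1) ^ j * legendre_coeff (of_nat (Suc m)) j * f j + (- 1) ^ j * legendre_coeff (of_nat m) j * f j
     = 2 * (of_nat m + 1) * ((- 1) ^ j * legendre_diff m j * f j)"
    unfolding w legendre_coeff_diff[of m] by (simp add: algebra_simps)
qed simp

text \<open>The weights 2m+3 and 2m+1 are chosen so that (2m+3)(m+1+j) - (2m+1)(m+1-j) =
  2(m+1)(2j+1), which cancels the denominator.\<close>

lemma sum_legendre_coeff_div_odd_Suc:
  "(2 * of_nat (Suc m) + 1)
       * (\<Sum>j\<le>Suc m. (- 1) ^ j * legendre_coeff (of_nat (Suc m)) j * (f j / (2 * of_nat j + 1)))
     - (2 * of_nat m + 1)
       * (\<Sum>j\<le>m. (- 1) ^ j * legendre_coeff (of_nat m) j * (f j / (2 * of_nat j + 1)))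
   = 2 * (of_nat m + 1) * (\<Sum>j\<le>Suc m. (- 1) ^ j * legendre_diff m j * f j)"
  unfolding sum_legendre_coeff_extend[of m] sum_subtractf[symmetric] sum_distrib_left
proof (rule sum.cong)
  fix j
  have nz: "2 * rat_of_nat j + 1 \<noteq> 0" using of_nat_add_1_neq_0[of "2 * j"] by simp
  have w: "legendre_coeff (of_nat (Suc m)) j = (of_nat m + 1 + of_nat j) * legendre_diff m j"
    using legendre_coeff_Suc_diff[of m j] by (simp add: add.commute)
  show "(2 * of_nat (Suc m) + 1)
       * ((- 1) ^ j * legendre_coeff (of_nat (Suc m)) j * (f j / (2 * of_nat j + 1)))
     - (2 * of_nat m + 1)
       * ((- 1) ^ j * legendre_coeff (of_nat m) j * (f j / (2 * of_nat j + 1)))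
     = 2 * (of_nat m + 1) * ((- 1) ^ j * legendre_diff m j * f j)"
    unfolding w legendre_coeff_diff[of m] using nz by (simp add: divide_simps) (simp add: algebra_simps)
qed simp

lemma sum_legendre_coeff: "(\<Sum>j\<le>m. (- 1) ^ j * legendre_coeff (of_nat m) j) = (- 1) ^ m"
proof (induction m)
  case (Suc m)
  show ?case
    using sum_legendre_coeff_Suc_add[of m "\<lambda>_. 1"] Suc.IH sum_legendre_diff[of m]
    by (simp del: sum.atMost_Suc)
qed simp

lemma sum_legendre_coeff_div_odd:
  "(2 * of_nat m + 1)
     * (\<Sum>j\<le>m. (- 1) ^ j * legendre_coeff (of_nat m) j * (1 / (2 * of_nat j + 1))) = 1"
proof (induction m)
  case (Suc m)
  show ?case
    using sum_legendre_coeff_div_odd_Suc[of m "\<lambda>_. 1"] Suc.IH sum_legendre_diff[of m]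
    by (simp del: sum.atMost_Suc)
qed simp

lemma two_mult_sum_legendre_diff_harmonic2:
  "2 * (of_nat m + 1) * (\<Sum>j\<le>Suc m. (- 1) ^ j * legendre_diff m j * harmonic2 j)
     = - 2 / (of_nat m + 1)\<^sup>2"
proof -
  define S where "S = (\<Sum>j\<le>Suc m. (- 1) ^ j * legendre_diff m j * harmonic2 j)"
  have nz: "(of_nat m + 1 :: rat)\<^sup>2 \<noteq> 0" using of_nat_add_1_neq_0[of m] by simp
  have "2 * (of_nat m + 1) * S * (of_nat m + 1)\<^sup>2 = - 2"
    using sum_legendre_diff_harmonic2[of m] unfolding S_def[symmetric] by Groebner_Basis.algebra
  then show ?thesis unfolding S_def[symmetric] nonzero_eq_divide_eq[OF nz] .
qed

text \<open>Consecutive sums add up to -2/(m+1)^2, and solving this recurrence produces the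
  alternating signs. With the denominator 2j+1 consecutive values are subtracted instead, hence the
  plain harmonic sum there.\<close>

lemma sum_legendre_coeff_harmonic2:
  "(\<Sum>j\<le>m. (- 1) ^ j * legendre_coeff (of_nat m) j * harmonic2 j)
     = - 2 * (- 1) ^ m * (\<Sum>k=1..m. (- 1) ^ k / (of_nat k)\<^sup>2)"
proof (induction m)
  case (Suc m)
  have "(\<Sum>j\<le>Suc m. (- 1) ^ j * legendre_coeff (of_nat (Suc m)) j * harmonic2 j)
      = - 2 / (of_nat m + 1)\<^sup>2 - - 2 * (- 1) ^ m * (\<Sum>k=1..m. (- 1) ^ k / (of_nat k)\<^sup>2)"
    using sum_legendre_coeff_Suc_add[of m harmonic2]
    unfolding two_mult_sum_legendre_diff_harmonic2 Suc.IH by (simp only: algebra_simps)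
  also have "\<dots> = - 2 * (- 1) ^ Suc m * (\<Sum>k=1..Suc m. (- 1) ^ k / (of_nat k)\<^sup>2)"
  proof -
    define e where "e = (- 1 :: rat) ^ m"
    have e: "e * e = 1" by (simp add: e_def flip: power_add mult_2)
    have "(\<Sum>k=1..Suc m. (- 1) ^ k / (rat_of_nat k)\<^sup>2)
        = (\<Sum>k=1..m. (- 1) ^ k / (of_nat k)\<^sup>2) - e * (1 / (of_nat m + 1)\<^sup>2)"
      by (simp add: e_def add.commute)
    then show ?thesis unfolding power_Suc e_def[symmetric] using e by (simp add: algebra_simps)
  qed
  finally show ?case .
qed simp

lemma sum_legendre_coeff_harmonic2_div_odd:
  "(2 * of_nat m + 1)
     * (\<Sum>j\<le>m. (- 1) ^ j * legendre_coeff (of_nat m) j * (harmonic2 j / (2 * of_nat j + 1)))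
   = - 2 * harmonic2 m"
proof (induction m)
  case (Suc m)
  show ?case
    using sum_legendre_coeff_div_odd_Suc[of m harmonic2]
    unfolding two_mult_sum_legendre_diff_harmonic2 Suc.IH harmonic2_Suc
    by (simp add: algebra_simps del: sum.atMost_Suc)
qed simp

section \<open>Rationals integral at a prime\<close>

text \<open>The reduced denominator divides every denominator of x, so any fraction with denominator
  prime to p suffices. The condition \<open>p \<noteq> 1\<close> excludes b = 0, because 0 is
  coprime only to units.\<close>

lemma denom_coprimeI:
  assumes "coprime b (int p)" "x = of_int a / of_int b" "p \<noteq> 1"
  shows "denom_coprime p x"
proof -
  have "b \<noteq> 0" using assms(1,3) by auto
  obtain n d where q: "quotient_of x = (n, d)" by (cases "quotient_of x")
  have d: "d > 0" "coprime n d" and x: "x = of_int n / of_int d"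
    using quotient_of_denom_pos[OF q] quotient_of_coprime[OF q] quotient_of_div[OF q] by auto
  have "rat_of_int n / of_int d = of_int a / of_int b" using x assms(2) by metis
  hence "rat_of_int (n * b) = of_int (a * d)"
    using d \<open>b \<noteq> 0\<close> by (simp add: frac_eq_eq)
  hence "n * b = a * d" by (simp only: of_int_eq_iff)
  hence "d dvd n * b" by (metis dvd_triv_right)
  hence "d dvd b" using d(2) by (simp add: coprime_commute coprime_dvd_mult_right_iff)
  thus ?thesis unfolding denom_coprime_def q snd_conv
    by (rule coprime_divisors[OF _ dvd_refl assms(1)])
qed

lemma denom_coprimeE:
  assumes "denom_coprime p x"
  obtains a b where "coprime b (int p)" "b \<noteq> 0" "x = of_int a / of_int b"
proof -
  obtain n d where q: "quotient_of x = (n, d)" by (cases "quotient_of x")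
  show thesis
    using that[of d n] quotient_of_denom_pos[OF q] quotient_of_div[OF q] assms q
    by (auto simp: denom_coprime_def)
qed

section \<open>Arithmetic in the localization at p\<close>

locale localization =
  fixes p :: nat
  assumes prime: "prime p"
begin

lemma p_neq_0 [simp]: "p \<noteq> 0"
  using prime by auto

text \<open>The ideal generated by $p^k$ in the localization of the integers at $p$.\<close>
definition ideal :: "nat \<Rightarrow> rat set" where
  "ideal k = {x. denom_coprime p (x / of_nat p ^ k)}"

lemma denom_coprime_add:
  assumes "denom_coprime p x" "denom_coprime p y"
  shows "denom_coprime p (x + y)"
proof -
  obtain a b where "coprime b (int p)" "b \<noteq> 0" "x = of_int a / of_int b"
    using assms(1) by (rule denom_coprimeE)
  moreover obtain c d where "coprime d (int p)" "d \<noteq> 0" "y = of_int c / of_int d"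
    using assms(2) by (rule denom_coprimeE)
  ultimately show ?thesis using prime
    by (intro denom_coprimeI[of "b * d" p _ "a * d + c * b"]) (auto simp: field_simps)
qed

lemma denom_coprime_mult:
  assumes "denom_coprime p x" "denom_coprime p y"
  shows "denom_coprime p (x * y)"
proof -
  obtain a b where "coprime b (int p)" "b \<noteq> 0" "x = of_int a / of_int b"
    using assms(1) by (rule denom_coprimeE)
  moreover obtain c d where "coprime d (int p)" "d \<noteq> 0" "y = of_int c / of_int d"
    using assms(2) by (rule denom_coprimeE)
  ultimately show ?thesis using prime
    by (intro denom_coprimeI[of "b * d" p _ "a * c"]) auto
qed

lemma ideal_0_iff: "x \<in> ideal 0 \<longleftrightarrow> denom_coprime p x"
  by (simp add: ideal_def)

lemma of_int_in_ideal: "of_int a \<in> ideal 0"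
  unfolding ideal_0_iff using prime by (intro denom_coprimeI[of 1 p _ a]) auto

lemma of_nat_in_ideal: "of_nat a \<in> ideal 0"
  using of_int_in_ideal[of "int a"] by simp

lemma numeral_in_ideal: "numeral a \<in> ideal 0"
  using of_int_in_ideal[of "numeral a"] by simp

lemma zero_in_ideal: "0 \<in> ideal k"
  using of_int_in_ideal[of 0] by (simp add: ideal_def)

lemma one_in_ideal: "1 \<in> ideal 0"
  using of_int_in_ideal[of 1] by simp

lemma ideal_add: "x \<in> ideal k \<Longrightarrow> y \<in> ideal k \<Longrightarrow> x + y \<in> ideal k"
  by (simp add: ideal_def add_divide_distrib denom_coprime_add)

lemma ideal_mult:
  assumes "x \<in> ideal k" "y \<in> ideal l"
  shows "x * y \<in> ideal (k + l)"
proof -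
  have "x * y / of_nat p ^ (k + l) = (x / of_nat p ^ k) * (y / of_nat p ^ l)"
    by (simp add: power_add)
  then show ?thesis using assms denom_coprime_mult unfolding ideal_def mem_Collect_eq by metis
qed

lemma ideal_mult_left: "x \<in> ideal 0 \<Longrightarrow> y \<in> ideal k \<Longrightarrow> x * y \<in> ideal k"
  using ideal_mult[of x 0 y k] by simp

lemma ideal_mult_right: "x \<in> ideal k \<Longrightarrow> y \<in> ideal 0 \<Longrightarrow> x * y \<in> ideal k"
  using ideal_mult[of x k y 0] by simp

lemma ideal_uminus: "x \<in> ideal k \<Longrightarrow> - x \<in> ideal k"
  using ideal_mult_left[of "- 1" x k] of_int_in_ideal[of "- 1"] by simp

lemma ideal_diff: "x \<in> ideal k \<Longrightarrow> y \<in> ideal k \<Longrightarrow> x - y \<in> ideal k"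
  using ideal_add[of x k "- y"] ideal_uminus[of y k] by simp

lemma ideal_sum: "(\<And>i. i \<in> A \<Longrightarrow> f i \<in> ideal k) \<Longrightarrow> sum f A \<in> ideal k"
  by (induction A rule: infinite_finite_induct) (auto simp: zero_in_ideal ideal_add)

lemma ideal_prod: "(\<And>i. i \<in> A \<Longrightarrow> f i \<in> ideal 0) \<Longrightarrow> prod f A \<in> ideal 0"
  by (induction A rule: infinite_finite_induct) (auto simp: one_in_ideal ideal_mult_left)

lemma ideal_power: "x \<in> ideal 0 \<Longrightarrow> x ^ n \<in> ideal 0"
  by (induction n) (auto simp: one_in_ideal ideal_mult_left)

lemma p_power_in_ideal: "of_nat p ^ k \<in> ideal k"
  using one_in_ideal by (simp add: ideal_def)

lemma p_in_ideal: "of_nat p \<in> ideal 1"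
  using p_power_in_ideal[of 1] by simp

lemma ideal_mono:
  assumes "x \<in> ideal k" "l \<le> k"
  shows "x \<in> ideal l"
proof -
  have "x / of_nat p ^ l = x / of_nat p ^ k * of_nat (p ^ (k - l))"
    using power_add[of "rat_of_nat p" l "k - l"] assms(2) by (simp add: divide_simps)
  then show ?thesis
    using ideal_mult_right[of "x / of_nat p ^ k" 0 "of_nat (p ^ (k - l))"] assms
      of_nat_in_ideal[of "p ^ (k - l)"]
    by (simp add: ideal_def)
qed

lemma inverse_of_nat_in_ideal:
  assumes "\<not> p dvd n"
  shows "1 / of_nat n \<in> ideal 0"
  unfolding ideal_0_iff using assms prime
  by (intro denom_coprimeI[of "int n" p _ 1])
    (auto simp: coprime_int_iff coprime_commute[of n] prime_imp_coprime)

lemma inverse_of_nat_in_ideal': "0 < n \<Longrightarrow> n < p \<Longrightarrow> 1 / of_nat n \<in> ideal 0"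
  by (rule inverse_of_nat_in_ideal) (auto dest: dvd_imp_le)

lemma inverse_fact_in_ideal: "n < p \<Longrightarrow> 1 / fact n \<in> ideal 0"
  using inverse_of_nat_in_ideal[of "fact n"] prime by (simp add: prime_dvd_fact_iff)

lemma ideal_divide_of_nat: "x \<in> ideal k \<Longrightarrow> \<not> p dvd n \<Longrightarrow> x / of_nat n \<in> ideal k"
  using ideal_mult_right[OF _ inverse_of_nat_in_ideal, of x k n] by simp

lemma fermat_in_ideal:
  assumes "\<not> p dvd n"
  shows "of_nat n ^ (p - 1) - 1 \<in> ideal 1"
proof -
  have "[n ^ (p - 1) = 1] (mod p)" by (rule fermat_theorem[OF prime assms])
  hence "[int n ^ (p - 1) = 1] (mod int p)"
    by (metis cong_int_iff of_nat_1 of_nat_power)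
  then obtain c where "int n ^ (p - 1) - 1 = int p * c"
    unfolding cong_iff_dvd_diff by (elim dvdE)
  hence "rat_of_int (int n ^ (p - 1) - 1) = of_int (int p * c)" by simp
  hence "rat_of_nat n ^ (p - 1) - 1 = of_nat p * of_int c" by simp
  then show ?thesis using ideal_mult_right[OF p_in_ideal of_int_in_ideal[of c]] by simp
qed

text \<open>Integrality of a follows from that of b and of the difference, so it need not be checked
  for the long sums.\<close>

lemma rat_congI:
  assumes "a - b \<in> ideal k" "b \<in> ideal 0"
  shows "rat_cong p k a b"
proof -
  have "a = (a - b) + b" by simp
  hence "a \<in> ideal 0" using ideal_add[OF ideal_mono[OF assms(1)] assms(2)] by simp
  then show ?thesis using assms unfolding rat_cong_def ideal_def by simp
qed

end

section \<open>Power sums and the Bernoulli and Euler series\<close>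

text \<open>A geometric series of ratio e^(2t), multiplied out to avoid dividing by a
  non-unit.\<close>

lemma fps_exp_even_sum:
  "(\<Sum>k\<le>m. fps_exp (2 * rat_of_nat k)) * (fps_exp 2 - 1) = fps_exp (2 * of_nat m + 2) - 1"
proof (induction m)
  case (Suc m)
  have "fps_exp (2 * rat_of_nat (Suc m) + 2) = fps_exp (2 * of_nat (Suc m)) * fps_exp 2"
    by (simp only: fps_exp_add_mult)
  moreover have "fps_exp (2 * rat_of_nat (Suc m)) = fps_exp (2 * of_nat m + 2)"
    by (simp add: algebra_simps)
  ultimately show ?case using Suc.IH by (simp add: algebra_simps)
qed simp

lemma fps_exp_even_alternating_sum:
  "(\<Sum>k\<le>m. fps_const ((- 1) ^ k) * fps_exp (2 * rat_of_nat k)) * (fps_exp 2 + 1)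
     = 1 + fps_const ((- 1) ^ m) * fps_exp (2 * of_nat m + 2)"
proof (induction m)
  case (Suc m)
  define s where "s = fps_const ((- 1 :: rat) ^ m)"
  define G where "G = fps_exp (2 * rat_of_nat m + 2)"
  have "fps_exp (2 * rat_of_nat (Suc m) + 2) = fps_exp (2 * of_nat (Suc m)) * fps_exp 2"
    by (simp only: fps_exp_add_mult)
  moreover have "fps_exp (2 * rat_of_nat (Suc m)) = G"
    by (simp add: G_def algebra_simps)
  moreover have "fps_const ((- 1) ^ Suc m) = - s" by (simp add: s_def)
  moreover have "1 + s * G + - s * G * (fps_exp 2 + 1) = 1 + - s * (G * fps_exp 2)"
    by (simp add: algebra_simps)
  ultimately show ?case
    unfolding sum.atMost_Suc distrib_right[of _ _ "fps_exp 2 + 1"] Suc.IH s_def[symmetric] G_def[symmetric]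
    by (simp only:)
qed simp

lemma fps_exp_compose_scale: "fps_exp (d :: rat) oo (fps_const c * fps_X) = fps_exp (c * d)"
  by (simp add: fps_compose_linear fps_eq_iff power_mult_distrib)

text \<open>This is the series 2t/(e^(2t) - 1).\<close>

definition fps_bernoulli2 :: "rat fps" where
  "fps_bernoulli2 = fps_bernoulli oo (fps_const 2 * fps_X)"

lemma fps_bernoulli2_nth: "fps_bernoulli2 $ n = 2 ^ n * fps_bernoulli $ n"
  by (simp add: fps_bernoulli2_def fps_compose_linear)

lemma fps_bernoulli2_mult: "fps_bernoulli2 * (fps_exp 2 - 1) = 2 * fps_X"
proof -
  have "fps_bernoulli2 * (fps_exp 2 - 1)
      = (fps_bernoulli * (fps_exp 1 - 1)) oo (fps_const 2 * fps_X)"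
    by (simp add: fps_bernoulli2_def fps_compose_mult_distrib fps_compose_sub_distrib
        fps_exp_compose_scale)
  also have "\<dots> = 2 * fps_X" unfolding fps_bernoulli_mult by (simp add: numeral_fps_const)
  finally show ?thesis .
qed

lemma fps_exp_1_square: "fps_exp 1 * fps_exp 1 = fps_exp (2 :: rat)"
  by (simp add: fps_exp_add_mult[symmetric])

text \<open>The geometric sum has numerator e^((2m+2)t) - 1. Splitting off one e^t and using 2t
  e^t/(e^(2t) - 1) = 2t/(e^t - 1) - 2t/(e^(2t) - 1) leaves the exponential of (2m+1)t = pt, which is
  harmless modulo p.\<close>

lemma fps_exp_even_sum_bernoulli:
  "2 * fps_X * (\<Sum>k\<le>m. fps_exp (2 * rat_of_nat k))
     = fps_exp (2 * of_nat m + 1) * (2 * fps_bernoulli - fps_bernoulli2) - fps_bernoulli2"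
proof -
  define F where "F = fps_exp (2 * rat_of_nat m + 1)"
  define E where "E = fps_exp (1 :: rat)"
  define S where "S = (\<Sum>k\<le>m. fps_exp (2 * rat_of_nat k))"
  have E2: "fps_exp 2 = E * E" by (simp add: E_def fps_exp_1_square)
  have "fps_exp (2 * rat_of_nat m + 2) = F * E"
    unfolding F_def E_def by (simp add: fps_exp_add_mult[symmetric])
  then have S: "S * (E * E - 1) = F * E - 1"
    using fps_exp_even_sum[of m] by (simp add: S_def E2)
  have b: "fps_bernoulli * (E * E - 1) = fps_X * (E + 1)"
    unfolding fps_bernoulli_mult[symmetric] E_def[symmetric] by (simp add: algebra_simps)
  have "(F * (2 * fps_bernoulli - fps_bernoulli2) - fps_bernoulli2) * (E * E - 1)
      = 2 * F * (fps_bernoulli * (E * E - 1)) - (F + 1) * (fps_bernoulli2 * (E * E - 1))"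
    by (simp add: algebra_simps)
  also have "\<dots> = 2 * fps_X * (F * E - 1)"
    unfolding b fps_bernoulli2_mult[unfolded E2] by (simp add: algebra_simps)
  also have "\<dots> = 2 * fps_X * S * (E * E - 1)" unfolding S[symmetric] by (simp only: mult.assoc)
  finally have "2 * fps_X * S * (E * E - 1)
      = (F * (2 * fps_bernoulli - fps_bernoulli2) - fps_bernoulli2) * (E * E - 1)" ..
  moreover have "E * E - 1 \<noteq> 0"
  proof
    assume "E * E - 1 = 0"
    hence "(E * E - 1) $ 1 = 0" by simp
    thus False by (simp add: E2[symmetric])
  qed
  ultimately show ?thesis by (simp add: F_def S_def)
qed

text \<open>Twice the geometric sum is 2/(e^(2t) + 1) plus (-1)^m e^((2m+1)t) times the Euler
  series. The first part contributes nothing in positive even degree.\<close>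

lemma fps_exp_even_alternating_sum_euler:
  assumes "even n" "n > 0"
  shows "2 * (\<Sum>k\<le>m. fps_const ((- 1) ^ k) * fps_exp (2 * rat_of_nat k)) $ n
     = (- 1) ^ m * (fps_exp (2 * of_nat m + 1) * fps_euler) $ n"
proof -
  define F where "F = fps_exp (2 * rat_of_nat m + 1)"
  define E where "E = fps_exp (1 :: rat)"
  define S where "S = (\<Sum>k\<le>m. fps_const ((- 1) ^ k) * fps_exp (2 * rat_of_nat k))"
  define s where "s = fps_const ((- 1 :: rat) ^ m)"
  \<comment> \<open>$D = 2/(e^{2t}+1)$, and $D(t) + D(-t) = 2$ kills the even coefficients.\<close>
  define D where "D = 2 * S - s * (F * fps_euler)"
  define D' where "D' = D oo (fps_const (- 1) * fps_X)"
  have E2: "fps_exp 2 = E * E" by (simp add: E_def fps_exp_1_square)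
  have "fps_exp (2 * rat_of_nat m + 2) = F * E"
    unfolding F_def E_def by (simp add: fps_exp_add_mult[symmetric])
  then have S: "S * (E * E + 1) = 1 + s * (F * E)"
    using fps_exp_even_alternating_sum[of m] by (simp add: S_def s_def E2)
  have "D * (E * E + 1) = 2 * (S * (E * E + 1)) - s * F * (fps_euler * (E * E + 1))"
    by (simp add: D_def algebra_simps)
  also have "\<dots> = 2"
    unfolding S fps_euler_mult[unfolded E2] E_def[symmetric] by (simp add: algebra_simps)
  finally have D: "D * (E * E + 1) = 2" .
  have E': "fps_exp (- 2) * (E * E) = (1 :: rat fps)"
    unfolding E2[symmetric] by (simp add: fps_exp_add_mult[symmetric])
  have "D' * (fps_exp (- 2) + 1) = (D * (fps_exp 2 + 1)) oo (fps_const (- 1) * fps_X)"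
    by (simp add: D'_def fps_compose_mult_distrib fps_compose_add_distrib fps_exp_compose_scale)
  also have "\<dots> = 2" unfolding E2 D by (simp add: numeral_fps_const)
  finally have D': "D' * (fps_exp (- 2) + 1) = 2" .
  have "D' * (E * E + 1) = D' * (fps_exp (- 2) * (E * E)) + D' * (E * E)"
    unfolding E' by (simp add: algebra_simps)
  also have "\<dots> = D' * (fps_exp (- 2) + 1) * (E * E)" by (simp add: algebra_simps)
  finally have D'': "D' * (E * E + 1) = 2 * (E * E)" unfolding D' .
  have "(D + D' - 2) * (E * E + 1) = 0"
    unfolding left_diff_distrib distrib_right[of D] D D'' by (simp add: algebra_simps)
  moreover have "E * E + 1 \<noteq> 0"
  proof
    assume "E * E + 1 = 0"
    hence "(E * E + 1) $ 1 = 0" by simp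
    thus False by (simp add: E2[symmetric])
  qed
  ultimately have "D + D' = 2" by simp
  hence "D $ n + D' $ n = 2 $ n" by (metis fps_add_nth)
  moreover have "D' $ n = D $ n" using assms by (simp add: D'_def fps_compose_linear)
  moreover have "(2 :: rat fps) $ n = 0" using assms by (simp add: numeral_fps_const)
  ultimately have "D $ n = 0" by simp
  then show ?thesis by (simp add: D_def S_def F_def s_def numeral_fps_const)
qed

section \<open>Integrality of the coefficients and reduction of e^(pt) modulo p\<close>

context localization
begin

text \<open>The coefficients p^i/i! of e^(pt) with 0 < i < p are divisible by p, so the factor
  e^(pt) acts as 1 modulo p.\<close>

lemma fps_exp_p_mult_nth:
  assumes "\<And>i. i \<le> n \<Longrightarrow> f $ i \<in> ideal 0" "n < p"
  shows "(fps_exp (of_nat p) * f) $ n - f $ n \<in> ideal 1"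
proof -
  have "(fps_exp (of_nat p) * f) $ n = (\<Sum>i=0..n. fps_exp (of_nat p) $ i * f $ (n - i))"
    by (rule fps_mult_nth)
  also have "\<dots> = f $ n + (\<Sum>i=1..n. of_nat p ^ i / fact i * f $ (n - i))"
    by (subst sum.atLeast_Suc_atMost) simp_all
  finally have "(fps_exp (of_nat p) * f) $ n - f $ n
      = (\<Sum>i=1..n. of_nat p ^ i / fact i * f $ (n - i))" by simp
  also have "\<dots> \<in> ideal 1"
  proof (rule ideal_sum)
    fix i assume i: "i \<in> {1..n}"
    have "of_nat p ^ i \<in> ideal 1" using i by (intro ideal_mono[OF p_power_in_ideal]) auto
    moreover have "1 / fact i \<in> ideal 0" using i assms(2) by (intro inverse_fact_in_ideal) auto
    moreover have "f $ (n - i) \<in> ideal 0" using assms(1) by simp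
    ultimately have "of_nat p ^ i * (1 / fact i) * f $ (n - i) \<in> ideal 1"
      by (intro ideal_mult_right)
    thus "of_nat p ^ i / fact i * f $ (n - i) \<in> ideal 1" by simp
  qed
  finally show ?thesis .
qed

text \<open>Solving the convolution for coefficient n divides only by factorials up to (n+1)!,
  whence the bound n+1 < p.\<close>

lemma fps_bernoulli_nth_in_ideal: "n + 1 < p \<Longrightarrow> fps_bernoulli $ n \<in> ideal 0"
proof (induction n rule: less_induct)
  case (less n)
  have "fps_X $ Suc n = (\<Sum>i=0..Suc n. fps_bernoulli $ i * (fps_exp 1 - 1) $ (Suc n - i))"
    unfolding fps_bernoulli_mult[symmetric] by (rule fps_mult_nth)
  \<comment> \<open>The term i = n+1 drops out because \<open>fps_exp 1 - 1\<close> has constant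
    coefficient 0; the recursion is therefore read off one degree higher.\<close>
  also have "\<dots> = (\<Sum>i=0..n. fps_bernoulli $ i * (fps_exp 1 - 1) $ (Suc n - i))" by simp
  also have "\<dots> = (\<Sum>i=0..n. fps_bernoulli $ i * (1 / fact (Suc n - i)))"
    by (rule sum.cong) auto
  also have "\<dots> = (\<Sum>i<n. fps_bernoulli $ i * (1 / fact (Suc n - i))) + fps_bernoulli $ n"
    by (simp add: atLeast0AtMost lessThan_Suc_atMost[symmetric] del: fact_Suc)
  finally have eq: "fps_bernoulli $ n
      = fps_X $ Suc n - (\<Sum>i<n. fps_bernoulli $ i * (1 / fact (Suc n - i)))" by simp
  have "fps_X $ Suc n \<in> ideal 0" by (simp add: one_in_ideal zero_in_ideal)
  moreover have "(\<Sum>i<n. fps_bernoulli $ i * (1 / fact (Suc n - i))) \<in> ideal 0"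
    using less by (intro ideal_sum ideal_mult_right inverse_fact_in_ideal) auto
  ultimately show ?case unfolding eq by (rule ideal_diff)
qed

text \<open>The same recursion, now also dividing by the constant coefficient 2 of
  \<open>fps_exp 2 + 1\<close>, hence p > 2.\<close>

lemma fps_euler_nth_in_ideal:
  assumes "p > 2"
  shows "n < p \<Longrightarrow> fps_euler $ n \<in> ideal 0"
proof (induction n rule: less_induct)
  case (less n)
  have "(2 * fps_exp 1) $ n = (\<Sum>i=0..n. fps_euler $ i * (fps_exp 2 + 1) $ (n - i))"
    unfolding fps_euler_mult[symmetric] by (rule fps_mult_nth)
  also have "\<dots> = (\<Sum>i<n. fps_euler $ i * (fps_exp 2 + 1) $ (n - i)) + 2 * fps_euler $ n"
    by (simp add: atLeast0AtMost lessThan_Suc_atMost[symmetric])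
  also have "(\<Sum>i<n. fps_euler $ i * (fps_exp 2 + 1) $ (n - i))
      = (\<Sum>i<n. fps_euler $ i * (2 ^ (n - i) * (1 / fact (n - i))))"
    by (rule sum.cong) auto
  finally have eq: "fps_euler $ n
      = 1 / fact n - (\<Sum>i<n. fps_euler $ i * (2 ^ (n - i) * (1 / fact (n - i)))) / of_nat 2"
    by (simp add: field_simps numeral_fps_const)
  have "\<not> p dvd 2" using assms by (auto dest: dvd_imp_le)
  moreover have "(\<Sum>i<n. fps_euler $ i * (2 ^ (n - i) * (1 / fact (n - i)))) \<in> ideal 0"
    using less by (intro ideal_sum ideal_mult_right inverse_fact_in_ideal ideal_power numeral_in_ideal) auto
  ultimately show ?case unfolding eq using less.prems
    by (intro ideal_diff inverse_fact_in_ideal ideal_divide_of_nat)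
qed

end

section \<open>The congruences\<close>

lemma sum_reflect:
  fixes f :: "nat \<Rightarrow> rat"
  shows "(\<Sum>i=1..2 * m. f i) = (\<Sum>i=1..m. f i + f (2 * m + 1 - i))"
proof -
  have "(\<Sum>i=1..2 * m. f i) = (\<Sum>i=1..m. f i) + (\<Sum>i=m + 1..2 * m. f i)"
    using sum.ub_add_nat[of 1 m f m] by (simp add: mult_2)
  also have "(\<Sum>i=m + 1..2 * m. f i) = (\<Sum>i=1..m. f (2 * m + 1 - i))"
    by (rule sum.reindex_bij_witness[of _ "\<lambda>i. 2 * m + 1 - i" "\<lambda>i. 2 * m + 1 - i"]) auto
  finally show ?thesis by (simp add: sum.distrib)
qed

text \<open>As 2m+1 is odd, reflecting the even indices gives exactly the odd ones.\<close>

lemma sum_even_odd: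
  fixes f :: "nat \<Rightarrow> rat"
  shows "(\<Sum>i=1..2 * m. f i) = (\<Sum>i=1..m. f (2 * i) + f (2 * m + 1 - 2 * i))"
proof -
  have "(\<Sum>i=1..2 * m. f i) = (\<Sum>i=1..m. f (2 * i)) + (\<Sum>i=1..m. f (2 * i - 1))"
    by (induction m) simp_all
  also have "(\<Sum>i=1..m. f (2 * i - 1)) = (\<Sum>i=1..m. f (2 * m + 1 - 2 * i))"
    by (rule sum.reindex_bij_witness[of _ "\<lambda>i. m + 1 - i" "\<lambda>i. m + 1 - i"])
      (auto intro!: arg_cong[of _ _ f])
  finally show ?thesis by (simp add: sum.distrib)
qed

lemma harmonic2_eq_sum: "harmonic2 m = (\<Sum>i=1..m. 1 / (of_nat i)\<^sup>2)"
  by (induction m) (simp_all add: harmonic2_Suc add.commute)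

text \<open>With p = 2x+1, the odd factor p^2 - (2K+1)^2 is 4(x(x+1) - K(K+1)), a Legendre
  numerator, and \<open>central_ratio\<close> exchanges its denominator for (2K+2)^2. The even
  factors give the remaining product and the sign.\<close>

lemma half_square_prod:
  "central_ratio j * square_coeff (2 * x + 1) (2 * j)
     = (- 1) ^ j * legendre_coeff x j * (\<Prod>i<j. 1 - (2 * x + 1)\<^sup>2 / (4 * (of_nat i + 1)\<^sup>2))"
proof (induction j)
  case (Suc j)
  define K where "K = rat_of_nat j"
  define e where "e = (- 1 :: rat) ^ j"
  have nz: "2 * K + 1 \<noteq> 0" "K + 1 \<noteq> 0"
    using of_nat_add_1_neq_0[of j] of_nat_add_1_neq_0[of "2 * j"] by (simp_all add: K_def)
  have sq: "(2 * (K + 1))\<^sup>2 = 4 * (K + 1)\<^sup>2" by (simp only: power_mult_distrib) simp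
  have "square_coeff (2 * x + 1) (2 * Suc j) = square_coeff (2 * x + 1) (2 * j)
      * (((2 * x + 1)\<^sup>2 - (2 * K + 1)\<^sup>2) / (2 * K + 1)\<^sup>2)
      * (((2 * x + 1)\<^sup>2 - (2 * (K + 1))\<^sup>2) / (2 * (K + 1))\<^sup>2)"
    by (simp add: square_coeff_Suc K_def algebra_simps)
  moreover have "central_ratio (Suc j) = central_ratio j * ((2 * K + 1)\<^sup>2 / (2 * (K + 1))\<^sup>2)"
    by (simp add: central_ratio_Suc K_def algebra_simps)
  ultimately have "central_ratio (Suc j) * square_coeff (2 * x + 1) (2 * Suc j)
      = (central_ratio j * square_coeff (2 * x + 1) (2 * j))
        * ((((2 * x + 1)\<^sup>2 - (2 * K + 1)\<^sup>2) / (2 * (K + 1))\<^sup>2)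
        * (((2 * x + 1)\<^sup>2 - (2 * (K + 1))\<^sup>2) / (2 * (K + 1))\<^sup>2))"
    using nz by simp
  also have "((2 * x + 1)\<^sup>2 - (2 * K + 1)\<^sup>2) / (2 * (K + 1))\<^sup>2 = (x * (x + 1) - K * (K + 1)) / (K + 1)\<^sup>2"
  proof -
    have "(2 * x + 1)\<^sup>2 - (2 * K + 1)\<^sup>2 = 4 * (x * (x + 1) - K * (K + 1))"
      by (simp add: power2_eq_square algebra_simps)
    then show ?thesis unfolding sq by (simp only: mult_divide_mult_cancel_left_if) simp
  qed
  also have "((2 * x + 1)\<^sup>2 - (2 * (K + 1))\<^sup>2) / (2 * (K + 1))\<^sup>2 = - (1 - (2 * x + 1)\<^sup>2 / (4 * (K + 1)\<^sup>2))"
    unfolding sq using nz by (simp add: diff_divide_distrib)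
  finally show ?case
    unfolding Suc.IH legendre_coeff_Suc prod.lessThan_Suc power_Suc K_def[symmetric] e_def[symmetric]
    by (simp only: mult_minus_left mult_minus_right mult_1_left mult_ac)
qed simp

context localization
begin

text \<open>The first-order expansion of 1/(p-a)^2 in p, with the exact remainder p^2 (3a - 2p)/(a^3
  b^2).\<close>

lemma pred_square_expansion:
  assumes "a + b = p" "0 < a" "0 < b"
  shows "1 / (of_nat b)\<^sup>2 - 1 / (of_nat a)\<^sup>2 - 2 * of_nat p / of_nat a ^ 3 \<in> ideal 2"
proof -
  have P: "rat_of_nat p = of_nat a + of_nat b" using assms(1) by (simp flip: of_nat_add)
  have "1 / (of_nat b)\<^sup>2 - 1 / (of_nat a)\<^sup>2 - 2 * of_nat p / of_nat a ^ 3
      = of_nat p ^ 2 * ((3 * of_nat a - 2 * of_nat p)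
          * ((1 / of_nat a) ^ 3 * (1 / of_nat b) ^ 2 :: rat))"
    unfolding P using assms(2,3)
    by (simp add: divide_simps) (simp add: algebra_simps eval_nat_numeral)
  also have "\<dots> \<in> ideal 2"
    using assms
    by (intro ideal_mult_right p_power_in_ideal ideal_mult_left ideal_diff ideal_power
        inverse_of_nat_in_ideal' numeral_in_ideal of_nat_in_ideal) auto
  finally show ?thesis .
qed

text \<open>Fermat's theorem in the form that converts power sums of exponent p-1-j into harmonic
  sums of order j.\<close>

lemma power_minus_inverse_in_ideal:
  assumes "\<not> p dvd n" "j \<le> p - 1"
  shows "of_nat n ^ (p - 1 - j) - 1 / of_nat n ^ j \<in> ideal 1"
proof -
  have "n \<noteq> 0" using assms(1) by (intro notI) simp
  moreover have "rat_of_nat n ^ (p - 1) = of_nat n ^ (p - 1 - j) * of_nat n ^ j"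
    by (metis assms(2) le_add_diff_inverse2 power_add)
  ultimately have "rat_of_nat n ^ (p - 1 - j) - 1 / of_nat n ^ j
      = (of_nat n ^ (p - 1) - 1) * (1 / of_nat n) ^ j"
    by (simp add: divide_simps left_diff_distrib)
  also have "\<dots> \<in> ideal 1"
    by (intro ideal_mult_right fermat_in_ideal ideal_power inverse_of_nat_in_ideal assms(1))
  finally show ?thesis .
qed

context
  fixes m :: nat
  assumes p_eq: "p = 2 * m + 1" and gt3: "p > 3"
begin

lemma not_dvd: "0 < k \<Longrightarrow> k < p \<Longrightarrow> \<not> p dvd k"
  by (auto dest: dvd_imp_le)

section \<open>Harmonic sums up to m in terms of Bernoulli and Euler numbers\<close>

lemma bernoulli_in_ideal: "bernoulli_number (p - 3) \<in> ideal 0"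
  unfolding bernoulli_number_def using gt3 of_nat_in_ideal[of "fact (p - 3)"]
  by (intro ideal_mult_left fps_bernoulli_nth_in_ideal) auto

lemma euler_in_ideal: "euler_number (p - 3) \<in> ideal 0"
  unfolding euler_number_def using gt3 of_nat_in_ideal[of "fact (p - 3)"]
  by (intro ideal_mult_left fps_euler_nth_in_ideal) auto

lemma p_rat_eq: "rat_of_nat p = 2 * of_nat m + 1"
  by (simp add: p_eq)

text \<open>Compare coefficients of t^(p-3) in \<open>fps_exp_even_sum_bernoulli\<close> with e^(pt)
  replaced by 1. The factor t on the left lowers the exponent of the power sum to p-4.\<close>

lemma even_power_sum_bernoulli:
  "of_nat (p - 3) * (\<Sum>k\<le>m. (2 * of_nat k) ^ (p - 4)) - (1 - 2 ^ (p - 3)) * bernoulli_number (p - 3)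
     \<in> ideal 1"
proof -
  define N where "N = p - 4"
  have N: "p - 3 = Suc N" "p - 4 = N" using gt3 by (auto simp: N_def)
  define S where "S = (\<Sum>k\<le>m. fps_exp (2 * rat_of_nat k))"
  define b where "b = fps_bernoulli $ Suc N"
  define f where "f = 2 * fps_bernoulli - fps_bernoulli2"
  define \<sigma> where "\<sigma> = (\<Sum>k\<le>m. (2 * rat_of_nat k) ^ N)"
  have f: "f $ i = (2 - 2 ^ i) * fps_bernoulli $ i" for i
    by (simp add: f_def fps_bernoulli2_nth numeral_fps_const algebra_simps)
  have fI: "f $ i \<in> ideal 0" if "i \<le> Suc N" for i
    unfolding f using that gt3
    by (intro ideal_mult_left ideal_diff ideal_power numeral_in_ideal fps_bernoulli_nth_in_ideal)
      (auto simp: N_def)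
  have S: "S $ N = \<sigma> / fact N"
    by (simp add: S_def \<sigma>_def fps_sum_nth sum_divide_distrib)
  have "(fps_exp (of_nat p) * f) $ Suc N - f $ Suc N \<in> ideal 1"
    using fI gt3 by (intro fps_exp_p_mult_nth) (auto simp: N_def)
  also have "(fps_exp (of_nat p) * f) $ Suc N = (2 * fps_X * S + fps_bernoulli2) $ Suc N"
    unfolding S_def fps_exp_even_sum_bernoulli p_rat_eq f_def by simp
  also have "\<dots> = 2 * (\<sigma> / fact N) + 2 ^ Suc N * b"
    by (simp add: numeral_fps_const mult.assoc S fps_bernoulli2_nth b_def)
  finally have "(fact (Suc N) * (2 * (\<sigma> / fact N) + 2 ^ Suc N * b - f $ Suc N)) / of_nat 2 \<in> ideal 1"
    using of_nat_in_ideal[of "fact (Suc N)"] gt3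
    by (intro ideal_divide_of_nat ideal_mult_left not_dvd) (simp_all only: of_nat_fact)
  also have "(fact (Suc N) * (2 * (\<sigma> / fact N) + 2 ^ Suc N * b - f $ Suc N)) / of_nat 2
      = of_nat (Suc N) * \<sigma> - (1 - 2 ^ Suc N) * (fact (Suc N) * b)"
    unfolding f b_def[symmetric] fact_Suc by (simp add: field_simps del: of_nat_Suc)
  finally show ?thesis unfolding N bernoulli_number_def b_def \<sigma>_def .
qed

lemma harmonic3_bernoulli:
  "(\<Sum>k=1..m. 1 / of_nat k ^ 3) + 2 * bernoulli_number (p - 3) \<in> ideal 1"
proof -
  define H where "H = (\<Sum>k=1..m. 1 / rat_of_nat k ^ 3)"
  define \<sigma> where "\<sigma> = (\<Sum>k\<le>m. (2 * rat_of_nat k) ^ (p - 4))"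
  define B where "B = bernoulli_number (p - 3)"
  define P where "P = rat_of_nat p"
  define t where "t = (2 :: rat) ^ (p - 3)"
  have B: "B \<in> ideal 0" unfolding B_def by (rule bernoulli_in_ideal)
  have P: "of_nat (p - 3) = P - 3" using gt3 by (simp add: P_def of_nat_diff)
  have 1: "(P - 3) * \<sigma> - (1 - t) * B \<in> ideal 1"
    using even_power_sum_bernoulli unfolding \<sigma>_def[symmetric] B_def[symmetric] t_def[symmetric] P .
  \<comment> \<open>Thus p-4 is positive and the term k = 0 of the power sum vanishes.\<close>
  have "p \<noteq> 4" using prime by auto
  have "\<sigma> = (\<Sum>k=1..m. (2 * rat_of_nat k) ^ (p - 4))"
    unfolding \<sigma>_def using gt3 \<open>p \<noteq> 4\<close>
    by (intro sum.mono_neutral_right) (auto simp: not_less_eq_eq)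
  hence "\<sigma> - H / 8 = (\<Sum>k=1..m. of_nat (2 * k) ^ (p - 1 - 3) - 1 / of_nat (2 * k) ^ 3)"
    by (simp add: H_def sum_divide_distrib sum_subtractf power_mult_distrib mult.commute)
  also have "\<dots> \<in> ideal 1"
    using gt3 by (intro ideal_sum power_minus_inverse_in_ideal not_dvd) (auto simp: p_eq)
  finally have 2: "\<sigma> - H / 8 \<in> ideal 1" .
  have "of_nat 2 ^ (p - 1) - 1 \<in> ideal 1" using gt3 by (intro fermat_in_ideal not_dvd) auto
  also have "p - 1 = Suc (Suc (p - 3))" using gt3 by auto
  finally have 3: "4 * t - 1 \<in> ideal 1" by (simp add: t_def)
  have "H \<in> ideal 0"
    unfolding H_def power_one_over[symmetric]
    by (intro ideal_sum ideal_power inverse_of_nat_in_ideal') (auto simp: p_eq)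
  hence 4: "P * (H / of_nat 8) \<in> ideal 1"
    unfolding P_def using prime_dvd_power[OF prime, of 2 3] not_dvd[of 2] gt3
    by (intro ideal_mult_right p_in_ideal ideal_divide_of_nat) auto
  have 5: "(4 * t - 1) * B / of_nat 4 \<in> ideal 1"
    using 3 B gt3 prime_dvd_power[OF prime, of 2 2] not_dvd[of 2]
    by (intro ideal_divide_of_nat ideal_mult_right[of "4 * t - 1"]) auto
  have 6: "(P - 3) * (\<sigma> - H / 8) \<in> ideal 1"
    using ideal_mult_left[OF of_nat_in_ideal[of "p - 3"] 2] unfolding P .
  \<comment> \<open>In this combination \<open>\<sigma>\<close> and \<open>t\<close> cancel, and the
    inner part becomes 3H/8 + 3B/4.\<close>
  have "(8 * (P * (H / of_nat 8) + (4 * t - 1) * B / of_nat 4 - ((P - 3) * \<sigma> - (1 - t) * B)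
      + (P - 3) * (\<sigma> - H / 8))) / of_nat 3 \<in> ideal 1"
    using gt3
    by (intro ideal_divide_of_nat ideal_mult_left[OF numeral_in_ideal]
        ideal_add[OF ideal_diff[OF ideal_add[OF 4 5] 1] 6] not_dvd) auto
  also have "(8 * (P * (H / of_nat 8) + (4 * t - 1) * B / of_nat 4 - ((P - 3) * \<sigma> - (1 - t) * B)
      + (P - 3) * (\<sigma> - H / 8))) / of_nat 3 = H + 2 * B"
    by (simp add: field_simps)
  finally show ?thesis unfolding H_def B_def .
qed

text \<open>The coefficient of t^(p-3), an even positive degree, makes twice the alternating power
  sum \<open>\<sigma>\<close> congruent to (-1)^m times the Euler number. By Fermat
  \<open>\<sigma>\<close> is also a quarter of the harmonic sum.\<close>

lemma alternating_harmonic2_euler: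
  "(\<Sum>k=1..m. (- 1) ^ k / (of_nat k)\<^sup>2) - 2 * (- 1) ^ m * euler_number (p - 3) \<in> ideal 1"
proof -
  define n where "n = p - 3"
  have n: "even n" "n > 0" "n < p" "p - 3 = n" "p - 1 - 2 = n" using gt3 by (auto simp: n_def p_eq)
  define S where "S = (\<Sum>k\<le>m. fps_const ((- 1) ^ k) * fps_exp (2 * rat_of_nat k))"
  define e where "e = (- 1 :: rat) ^ m"
  have e: "e \<in> ideal 0" using ideal_power[OF ideal_uminus[OF one_in_ideal]] by (simp add: e_def)
  define \<sigma> where "\<sigma> = (\<Sum>k=1..m. (- 1) ^ k * (2 * rat_of_nat k) ^ n)"
  define A where "A = (\<Sum>k=1..m. (- 1) ^ k / (rat_of_nat k)\<^sup>2)"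
  have "S $ n = (\<Sum>k\<le>m. (- 1) ^ k * ((2 * rat_of_nat k) ^ n / fact n))"
    by (simp add: S_def fps_sum_nth)
  also have "\<dots> = (\<Sum>k=1..m. (- 1) ^ k * ((2 * rat_of_nat k) ^ n / fact n))"
    using n by (intro sum.mono_neutral_right) (auto simp: not_less_eq_eq)
  also have "\<dots> = \<sigma> / fact n" by (simp add: \<sigma>_def sum_divide_distrib)
  finally have S: "S $ n = \<sigma> / fact n" .
  have E: "2 * (\<sigma> / fact n) = e * (fps_exp (of_nat p) * fps_euler) $ n"
    using fps_exp_even_alternating_sum_euler[OF n(1,2), of m] unfolding S_def[symmetric] S e_def p_rat_eq .
  have "(fps_exp (of_nat p) * fps_euler) $ n - fps_euler $ n \<in> ideal 1"
    using n gt3 by (intro fps_exp_p_mult_nth fps_euler_nth_in_ideal) auto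
  hence "fact n * (e * ((fps_exp (of_nat p) * fps_euler) $ n - fps_euler $ n)) \<in> ideal 1"
    using of_nat_in_ideal[of "fact n"] e by (intro ideal_mult_left) auto
  also have "fact n * (e * ((fps_exp (of_nat p) * fps_euler) $ n - fps_euler $ n))
      = fact n * (2 * (\<sigma> / fact n)) - e * (fact n * fps_euler $ n)"
    unfolding E by (simp add: algebra_simps)
  finally have 1: "2 * \<sigma> - e * euler_number n \<in> ideal 1" by (simp add: euler_number_def)
  have "\<sigma> - A / 4 = (\<Sum>k=1..m. (- 1) ^ k * (of_nat (2 * k) ^ n - 1 / of_nat (2 * k) ^ 2))"
    by (simp add: \<sigma>_def A_def sum_divide_distrib sum_subtractf power_mult_distrib algebra_simps)
  also have "\<dots> \<in> ideal 1"
    unfolding n(5)[symmetric] using gt3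
    by (intro ideal_sum ideal_mult_left ideal_power ideal_uminus one_in_ideal
        power_minus_inverse_in_ideal not_dvd) (auto simp: p_eq)
  finally have 2: "\<sigma> - A / 4 \<in> ideal 1" .
  have "2 * (2 * \<sigma> - e * euler_number n) - 4 * (\<sigma> - A / 4) \<in> ideal 1"
    by (rule ideal_diff[OF ideal_mult_left[OF numeral_in_ideal 1] ideal_mult_left[OF numeral_in_ideal 2]])
  also have "2 * (2 * \<sigma> - e * euler_number n) - 4 * (\<sigma> - A / 4) = A - 2 * e * euler_number n"
    by simp
  finally show ?thesis unfolding A_def e_def n .
qed

text \<open>The sum A of 1/i^2 over 0 < i < p is evaluated twice modulo p^2: reflection gives 2H +
  2pK, separation by parity gives H/2 + pK/4.\<close>

lemma harmonic2_harmonic3: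
  "harmonic2 m + 7 / 6 * of_nat p * (\<Sum>k=1..m. 1 / of_nat k ^ 3) \<in> ideal 2"
proof -
  define H where "H = harmonic2 m"
  define K where "K = (\<Sum>k=1..m. 1 / rat_of_nat k ^ 3)"
  define P where "P = rat_of_nat p"
  define f where "f i = 1 / (rat_of_nat i)\<^sup>2" for i
  define A where "A = (\<Sum>i=1..2 * m. f i)"
  have H: "(\<Sum>i=1..m. f i) = H" by (simp add: H_def f_def harmonic2_eq_sum)
  have "(\<Sum>i=1..m. f (2 * m + 1 - i) - f i - 2 * P / of_nat i ^ 3) \<in> ideal 2"
    unfolding f_def P_def by (intro ideal_sum pred_square_expansion) (auto simp: p_eq)
  also have "(\<Sum>i=1..m. f (2 * m + 1 - i) - f i - 2 * P / of_nat i ^ 3)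
      = (\<Sum>i=1..m. f i + f (2 * m + 1 - i)) - 2 * (\<Sum>i=1..m. f i) - 2 * P * K"
    by (simp add: sum_subtractf sum.distrib K_def sum_distrib_left)
  finally have 1: "A - 2 * H - 2 * P * K \<in> ideal 2" unfolding H sum_reflect[symmetric] A_def .
  have "(\<Sum>i=1..m. f (2 * m + 1 - 2 * i) - f (2 * i) - 2 * P / of_nat (2 * i) ^ 3) \<in> ideal 2"
    unfolding f_def P_def by (intro ideal_sum pred_square_expansion) (auto simp: p_eq)
  also have "(\<Sum>i=1..m. f (2 * m + 1 - 2 * i) - f (2 * i) - 2 * P / of_nat (2 * i) ^ 3)
      = (\<Sum>i=1..m. f (2 * i) + f (2 * m + 1 - 2 * i)) - (\<Sum>i=1..m. f i) / 2 - P * K / 4"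
    by (simp add: sum_subtractf sum.distrib K_def sum_distrib_left sum_divide_distrib f_def
        power_mult_distrib mult.commute)
  finally have 2: "A - H / 2 - P * K / 4 \<in> ideal 2" unfolding H sum_even_odd[symmetric] A_def .
  have "2 * ((A - H / 2 - P * K / 4) - (A - 2 * H - 2 * P * K)) / of_nat 3 \<in> ideal 2"
    using gt3 by (intro ideal_divide_of_nat ideal_mult_left[OF numeral_in_ideal] ideal_diff[OF 2 1] not_dvd) auto
  also have "2 * ((A - H / 2 - P * K / 4) - (A - 2 * H - 2 * P * K)) / of_nat 3 = H + 7 / 6 * P * K"
    by (simp add: field_simps)
  finally show ?thesis unfolding H_def P_def K_def .
qed

lemma harmonic2_bernoulli: "harmonic2 m - 7 / 3 * of_nat p * bernoulli_number (p - 3) \<in> ideal 2"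
proof -
  define K where "K = (\<Sum>k=1..m. 1 / rat_of_nat k ^ 3)"
  define B where "B = bernoulli_number (p - 3)"
  have "of_nat p * (7 * (K + 2 * B) / of_nat 6) \<in> ideal (1 + 1)"
    using harmonic3_bernoulli gt3 prime_dvd_mult_nat[OF prime, of 2 3] not_dvd[of 2] not_dvd[of 3]
    unfolding K_def B_def
    by (intro ideal_mult p_in_ideal ideal_divide_of_nat ideal_mult_left numeral_in_ideal) auto
  moreover have "harmonic2 m + 7 / 6 * of_nat p * K \<in> ideal 2"
    unfolding K_def by (rule harmonic2_harmonic3)
  ultimately have "(harmonic2 m + 7 / 6 * of_nat p * K) - of_nat p * (7 * (K + 2 * B) / of_nat 6) \<in> ideal 2"
    by (intro ideal_diff) (simp_all add: numeral_2_eq_2)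
  also have "(harmonic2 m + 7 / 6 * of_nat p * K) - of_nat p * (7 * (K + 2 * B) / of_nat 6)
      = harmonic2 m - 7 / 3 * of_nat p * B"
    by (simp add: field_simps)
  finally show ?thesis unfolding B_def .
qed

text \<open>Integrality of \<open>harmonic2 j\<close> is carried through the induction because it
  enters the remainder of the next step.\<close>

lemma half_prod_expansion:
  "j < p \<Longrightarrow> \<exists>r \<in> ideal 0. (\<Prod>i<j. 1 - (of_nat p)\<^sup>2 / (4 * (of_nat i + 1)\<^sup>2))
      = 1 - (of_nat p)\<^sup>2 / 4 * harmonic2 j + of_nat p ^ 4 * r \<and> harmonic2 j \<in> ideal 0"
proof (induction j)
  case 0
  then show ?case using zero_in_ideal by (auto intro: bexI[of _ 0])
next
  case (Suc j)
  then obtain r where r: "r \<in> ideal 0" "harmonic2 j \<in> ideal 0"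
    "(\<Prod>i<j. 1 - (of_nat p)\<^sup>2 / (4 * (of_nat i + 1)\<^sup>2))
      = 1 - (of_nat p)\<^sup>2 / 4 * harmonic2 j + of_nat p ^ 4 * r"
    by auto
  define q where "q = 1 / (rat_of_nat j + 1)\<^sup>2"
  have q: "q \<in> ideal 0"
    using ideal_power[OF inverse_of_nat_in_ideal'[of "Suc j"], of 2] Suc.prems
    by (simp add: q_def power_one_over add.commute)
  define c where "c = 1 / rat_of_nat 4"
  have c: "c \<in> ideal 0"
    using prime_dvd_power[OF prime, of 2 2] not_dvd[of 2] gt3
    unfolding c_def by (intro inverse_of_nat_in_ideal) auto
  define P where "P = (rat_of_nat p)\<^sup>2"
  \<comment> \<open>These are the terms of degree at least 2 in P = p^2, divided by P^2.\<close>
  define r' where "r' = r + c * c * harmonic2 j * q - P * c * r * q"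
  have r': "r' \<in> ideal 0"
    unfolding r'_def P_def using r q c
    by (intro ideal_add ideal_diff ideal_mult_left ideal_power of_nat_in_ideal)
  have P4: "rat_of_nat p ^ 4 = P * P" by (simp add: P_def flip: power_add)
  have "(\<Prod>i<Suc j. 1 - (of_nat p)\<^sup>2 / (4 * (of_nat i + 1)\<^sup>2))
      = (1 - P * c * harmonic2 j + P * P * r) * (1 - P * c * q)"
    unfolding prod.lessThan_Suc r(3) unfolding P4 P_def[symmetric] by (simp add: c_def q_def)
  also have "\<dots> = 1 - P * c * (harmonic2 j + q) + P * P * r'"
    by (simp add: r'_def algebra_simps)
  finally have "(\<Prod>i<Suc j. 1 - (of_nat p)\<^sup>2 / (4 * (of_nat i + 1)\<^sup>2))
      = 1 - (of_nat p)\<^sup>2 / 4 * harmonic2 (Suc j) + of_nat p ^ 4 * r'"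
    unfolding harmonic2_Suc q_def[symmetric] P4 by (simp add: P_def c_def)
  moreover have "harmonic2 (Suc j) \<in> ideal 0"
    unfolding harmonic2_Suc q_def[symmetric] using r q by (intro ideal_add)
  ultimately show ?case using r' by blast
qed

section \<open>Evaluation of the sums over T modulo powers of p\<close>

lemma legendre_coeff_in_ideal: "j < p \<Longrightarrow> legendre_coeff (of_nat n) j \<in> ideal 0"
proof -
  assume j: "j < p"
  have "((of_nat n * (of_nat n + 1) - of_nat i * (of_nat i + 1)) * (1 / of_nat (Suc i)) ^ 2 :: rat) \<in> ideal 0"
    if "i < j" for i
    using that j
    by (intro ideal_mult_left ideal_diff ideal_power inverse_of_nat_in_ideal' ideal_add
        of_nat_in_ideal one_in_ideal) auto
  then show ?thesis
    unfolding legendre_coeff_def by (intro ideal_prod) (simp add: power_one_over add.commute)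
qed

lemma square_coeff_expansion:
  obtains r where "\<And>j. j \<le> m \<Longrightarrow> r j \<in> ideal 0"
    "\<And>j. j \<le> m \<Longrightarrow> central_ratio j * square_coeff (of_nat p) (2 * j)
       = (- 1) ^ j * legendre_coeff (of_nat m) j * (1 - (of_nat p)\<^sup>2 / 4 * harmonic2 j)
         + of_nat p ^ 4 * r j"
proof -
  have "\<forall>j\<in>{..m}. \<exists>r \<in> ideal 0. (\<Prod>i<j. 1 - (of_nat p)\<^sup>2 / (4 * (of_nat i + 1)\<^sup>2))
      = 1 - (of_nat p)\<^sup>2 / 4 * harmonic2 j + of_nat p ^ 4 * r"
    using half_prod_expansion by (force simp: p_eq)
  then obtain r where r: "\<And>j. j \<le> m \<Longrightarrow> r j \<in> ideal 0"
    "\<And>j. j \<le> m \<Longrightarrow> (\<Prod>i<j. 1 - (of_nat p)\<^sup>2 / (4 * (of_nat i + 1)\<^sup>2))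
      = 1 - (of_nat p)\<^sup>2 / 4 * harmonic2 j + of_nat p ^ 4 * r j"
    unfolding bchoice_iff Bex_def by auto
  show thesis
  proof (rule that[of "\<lambda>j. (- 1) ^ j * legendre_coeff (of_nat m) j * r j"])
    fix j assume j: "j \<le> m"
    show "(- 1) ^ j * legendre_coeff (of_nat m) j * r j \<in> ideal 0"
      using j r
      by (intro ideal_mult_left ideal_power ideal_uminus one_in_ideal legendre_coeff_in_ideal)
        (auto simp: p_eq)
    have "central_ratio j * square_coeff (of_nat p) (2 * j) = (- 1) ^ j * legendre_coeff (of_nat m) j
        * (\<Prod>i<j. 1 - (of_nat p)\<^sup>2 / (4 * (of_nat i + 1)\<^sup>2))"
      unfolding p_rat_eq by (rule half_square_prod)
    then show "central_ratio j * square_coeff (of_nat p) (2 * j)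
        = (- 1) ^ j * legendre_coeff (of_nat m) j * (1 - (of_nat p)\<^sup>2 / 4 * harmonic2 j)
          + of_nat p ^ 4 * ((- 1) ^ j * legendre_coeff (of_nat m) j * r j)"
      unfolding r(2)[OF j] by (simp add: algebra_simps)
  qed
qed

text \<open>One range for j, valid for every k below p, is what allows the two summations to be
  exchanged.\<close>

lemma T_eq_sum_central_ratio:
  assumes "k < p"
  shows "of_nat (T k) / 4 ^ k = (\<Sum>j\<le>m. central_ratio j * legendre_coeff (of_nat k) (2 * j))"
    and "of_nat (T k) / (- 4) ^ k = (- 1) ^ k * (\<Sum>j\<le>m. central_ratio j * legendre_coeff (of_nat k) (2 * j))"
proof -
  have L: "legendre_sum k = (\<Sum>j\<le>m. central_ratio j * legendre_coeff (of_nat k) (2 * j))"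
    using assms p_eq by (intro legendre_sum_eq) auto
  show "of_nat (T k) / 4 ^ k = (\<Sum>j\<le>m. central_ratio j * legendre_coeff (of_nat k) (2 * j))"
    unfolding T_eq_legendre_sum L by simp
  have "(- 4 :: rat) ^ k = (- 1) ^ k * 4 ^ k" by (simp flip: power_mult_distrib)
  then show "of_nat (T k) / (- 4) ^ k
      = (- 1) ^ k * (\<Sum>j\<le>m. central_ratio j * legendre_coeff (of_nat k) (2 * j))"
    unfolding T_eq_legendre_sum L[symmetric] by (simp add: divide_simps)
qed

lemma sum_T_4:
  "(\<Sum>k<p. of_nat (2 * k + 1) * (of_nat (T k) / 4 ^ k)) - (of_nat p + of_nat p ^ 3 / 2 * harmonic2 m)
     \<in> ideal 5"
proof -
  obtain r where r: "\<And>j. j \<le> m \<Longrightarrow> r j \<in> ideal 0"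
    "\<And>j. j \<le> m \<Longrightarrow> central_ratio j * square_coeff (of_nat p) (2 * j)
       = (- 1) ^ j * legendre_coeff (of_nat m) j * (1 - (of_nat p)\<^sup>2 / 4 * harmonic2 j)
         + of_nat p ^ 4 * r j"
    by (rule square_coeff_expansion) blast
  define P where "P = rat_of_nat p"
  define w where "w j = (- 1) ^ j * legendre_coeff (of_nat m) j" for j
  define d where "d j = 2 * rat_of_nat j + 1" for j
  have d: "d j \<noteq> 0" for j using of_nat_add_1_neq_0[of "2 * j"] by (simp add: d_def)
  have P0: "P \<noteq> 0" by (simp add: P_def)
  have "(\<Sum>k<p. of_nat (2 * k + 1) * (of_nat (T k) / 4 ^ k))
      = (\<Sum>k<p. \<Sum>j\<le>m. central_ratio j * ((2 * of_nat k + 1) * legendre_coeff (of_nat k) (2 * j)))"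
    by (rule sum.cong) (simp_all add: T_eq_sum_central_ratio sum_distrib_left mult_ac add.commute)
  also have "\<dots> = (\<Sum>j\<le>m. central_ratio j * (\<Sum>k<p. (2 * of_nat k + 1) * legendre_coeff (of_nat k) (2 * j)))"
    by (subst sum.swap) (simp only: sum_distrib_left)
  also have "\<dots> = (\<Sum>j\<le>m. central_ratio j * (P\<^sup>2 * square_coeff P (2 * j) / d j))"
  proof (rule sum.cong)
    fix j
    have "(\<Sum>k<p. (2 * of_nat k + 1) * legendre_coeff (of_nat k) (2 * j)) = P\<^sup>2 * square_coeff P (2 * j) / d j"
      using sum_odd_legendre_coeff[of "2 * j" p] d[of j]
      by (simp add: P_def d_def nonzero_eq_divide_eq mult.commute)
    then show "central_ratio j * (\<Sum>k<p. (2 * of_nat k + 1) * legendre_coeff (of_nat k) (2 * j))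
      = central_ratio j * (P\<^sup>2 * square_coeff P (2 * j) / d j)" by simp
  qed simp
  also have "\<dots> = (\<Sum>j\<le>m. P\<^sup>2 * (w j * (1 / d j)) - P ^ 4 / 4 * (w j * (harmonic2 j / d j))
      + P ^ 5 * (r j * (P / d j)))"
  proof (rule sum.cong)
    fix j assume "j \<in> {..m}"
    hence "central_ratio j * square_coeff P (2 * j) = w j * (1 - P\<^sup>2 / 4 * harmonic2 j) + P ^ 4 * r j"
      using r(2)[of j] by (simp add: P_def w_def)
    hence "central_ratio j * (P\<^sup>2 * square_coeff P (2 * j) / d j)
        = P\<^sup>2 * (w j * (1 - P\<^sup>2 / 4 * harmonic2 j) + P ^ 4 * r j) / d j"
      by (metis (no_types, lifting) mult.left_commute times_divide_eq_right)
    also have "\<dots> = P\<^sup>2 * (w j * (1 / d j)) - P ^ 4 / 4 * (w j * (harmonic2 j / d j))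
      + P ^ 5 * (r j * (P / d j))"
      using d[of j] by (simp add: field_simps power2_eq_square power4_eq_xxxx eval_nat_numeral)
    finally show "central_ratio j * (P\<^sup>2 * square_coeff P (2 * j) / d j) = \<dots>" .
  qed simp
  also have "\<dots> = P\<^sup>2 * (\<Sum>j\<le>m. w j * (1 / d j)) - P ^ 4 / 4 * (\<Sum>j\<le>m. w j * (harmonic2 j / d j))
      + P ^ 5 * (\<Sum>j\<le>m. r j * (P / d j))"
    by (simp only: sum.distrib sum_subtractf sum_distrib_left)
  also have "(\<Sum>j\<le>m. w j * (1 / d j)) = 1 / P"
  proof -
    have "P * (\<Sum>j\<le>m. w j * (1 / d j)) = 1"
      unfolding P_def p_rat_eq w_def d_def by (rule sum_legendre_coeff_div_odd)
    then show ?thesis using P0 by (metis nonzero_mult_div_cancel_left)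
  qed
  also have "(\<Sum>j\<le>m. w j * (harmonic2 j / d j)) = - 2 * harmonic2 m / P"
  proof -
    have "P * (\<Sum>j\<le>m. w j * (harmonic2 j / d j)) = - 2 * harmonic2 m"
      unfolding P_def p_rat_eq w_def d_def by (rule sum_legendre_coeff_harmonic2_div_odd)
    then show ?thesis using P0 by (metis nonzero_mult_div_cancel_left)
  qed
  also have "P\<^sup>2 * (1 / P) - P ^ 4 / 4 * (- 2 * harmonic2 m / P) = P + P ^ 3 / 2 * harmonic2 m"
    using P0 by (simp add: field_simps eval_nat_numeral)
  finally have "(\<Sum>k<p. of_nat (2 * k + 1) * (of_nat (T k) / 4 ^ k)) - (P + P ^ 3 / 2 * harmonic2 m)
      = P ^ 5 * (\<Sum>j\<le>m. r j * (P / d j))" by simp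
  also have "\<dots> \<in> ideal 5"
  proof (unfold P_def, intro ideal_mult_right p_power_in_ideal ideal_sum ideal_mult_left)
    fix j assume j: "j \<in> {..m}"
    show "r j \<in> ideal 0" using j r by simp
    \<comment> \<open>At j = m the denominator 2j+1 is p itself. One factor p is kept to absorb it,
      so the error is p^5 instead of p^6.\<close>
    show "of_nat p / d j \<in> ideal 0"
    proof (cases "j = m")
      case True
      then show ?thesis using p_rat_eq d[of m] one_in_ideal by (simp add: d_def)
    next
      case False
      have "rat_of_nat p / of_nat (2 * j + 1) \<in> ideal 0"
        using False j p_eq by (intro ideal_divide_of_nat of_nat_in_ideal not_dvd) auto
      then show ?thesis by (simp add: d_def add.commute)
    qed
  qed
  finally show ?thesis unfolding P_def .
qed

lemma sum_T_minus_4: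
  "(\<Sum>k<p. of_nat (2 * k + 1) * (of_nat (T k) / (- 4) ^ k))
     - ((- 1) ^ m * of_nat p + of_nat p ^ 3 / 2 * (- 1) ^ m * (\<Sum>k=1..m. (- 1) ^ k / (of_nat k)\<^sup>2))
     \<in> ideal 4"
proof -
  obtain r where r: "\<And>j. j \<le> m \<Longrightarrow> r j \<in> ideal 0"
    "\<And>j. j \<le> m \<Longrightarrow> central_ratio j * square_coeff (of_nat p) (2 * j)
       = (- 1) ^ j * legendre_coeff (of_nat m) j * (1 - (of_nat p)\<^sup>2 / 4 * harmonic2 j)
         + of_nat p ^ 4 * r j"
    by (rule square_coeff_expansion) blast
  define P where "P = rat_of_nat p"
  define w where "w j = (- 1) ^ j * legendre_coeff (of_nat m) j" for j
  define A where "A = (\<Sum>k=1..m. (- 1) ^ k / (rat_of_nat k)\<^sup>2)"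
  define e where "e = (- 1 :: rat) ^ m"
  \<comment> \<open>Since p is odd, the two signs in the alternating closed form cancel.\<close>
  have "(- 1 :: rat) ^ p = - 1" by (simp add: p_eq)
  note alt = alternating_sum_odd_legendre_coeff[where N = p, unfolded this, folded P_def]
  have "(\<Sum>k<p. of_nat (2 * k + 1) * (of_nat (T k) / (- 4) ^ k))
      = (\<Sum>k<p. \<Sum>j\<le>m. central_ratio j * ((- 1) ^ k * (2 * of_nat k + 1) * legendre_coeff (of_nat k) (2 * j)))"
    by (rule sum.cong) (simp_all add: T_eq_sum_central_ratio sum_distrib_left mult_ac add.commute)
  also have "\<dots> = (\<Sum>j\<le>m. central_ratio j
      * (\<Sum>k<p. (- 1) ^ k * (2 * of_nat k + 1) * legendre_coeff (of_nat k) (2 * j)))"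
    by (subst sum.swap) (simp only: sum_distrib_left)
  also have "\<dots> = (\<Sum>j\<le>m. P * (central_ratio j * square_coeff P (2 * j)))"
    unfolding alt by (simp add: mult_ac)
  also have "\<dots> = (\<Sum>j\<le>m. P * w j - P ^ 3 / 4 * (w j * harmonic2 j) + P ^ 4 * (P * r j))"
  proof (rule sum.cong)
    fix j assume "j \<in> {..m}"
    hence c: "central_ratio j * square_coeff P (2 * j) = w j * (1 - P\<^sup>2 / 4 * harmonic2 j) + P ^ 4 * r j"
      using r(2)[of j] by (simp add: P_def w_def)
    show "P * (central_ratio j * square_coeff P (2 * j))
        = P * w j - P ^ 3 / 4 * (w j * harmonic2 j) + P ^ 4 * (P * r j)"
      unfolding c by (simp add: algebra_simps eval_nat_numeral)
  qed simp
  also have "\<dots> = P * (\<Sum>j\<le>m. w j) - P ^ 3 / 4 * (\<Sum>j\<le>m. w j * harmonic2 j) + P ^ 4 * (\<Sum>j\<le>m. P * r j)"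
    by (simp only: sum.distrib sum_subtractf sum_distrib_left)
  also have "(\<Sum>j\<le>m. w j) = e" unfolding w_def e_def by (rule sum_legendre_coeff)
  also have "(\<Sum>j\<le>m. w j * harmonic2 j) = - 2 * e * A"
    unfolding w_def e_def A_def by (rule sum_legendre_coeff_harmonic2)
  finally have "(\<Sum>k<p. of_nat (2 * k + 1) * (of_nat (T k) / (- 4) ^ k)) - (e * P + P ^ 3 / 2 * e * A)
      = P ^ 4 * (\<Sum>j\<le>m. P * r j)" by simp
  also have "\<dots> \<in> ideal 4"
    unfolding P_def using r(1)
    by (intro ideal_mult_right p_power_in_ideal ideal_sum ideal_mult_left of_nat_in_ideal) auto
  finally show ?thesis unfolding P_def e_def A_def .
qed

lemma seven_sixths_in_ideal: "7 / 6 \<in> ideal 0"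
  \<comment> \<open>The \<open>num\<close> term denotes 7; the denominator 6 is prime to p because p
    > 3.\<close>
  using ideal_divide_of_nat[OF numeral_in_ideal, of 6 "num.Bit1 (num.Bit1 num.One)"] gt3
    prime_dvd_mult_nat[OF prime, of 2 3] not_dvd[of 2] not_dvd[of 3] by auto

text \<open>\<open>harmonic2 m\<close> is known modulo p^2 and enters with the factor p^3/2, which
  matches the modulus p^5.\<close>

lemma rat_cong_sum_T_4:
  "rat_cong p 5 (\<Sum>k<p. of_nat (2 * k + 1) * (of_nat (T k) / 4 ^ k))
     (of_nat p + 7 / 6 * of_nat p ^ 4 * bernoulli_number (p - 3))"
proof (rule rat_congI)
  define B where "B = bernoulli_number (p - 3)"
  define S where "S = (\<Sum>k<p. of_nat (2 * k + 1) * (rat_of_nat (T k) / 4 ^ k))"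
  define P where "P = rat_of_nat p"
  have "P ^ 3 * ((harmonic2 m - 7 / 3 * P * B) / of_nat 2) \<in> ideal (3 + 2)"
    unfolding P_def B_def using gt3
    by (intro ideal_mult p_power_in_ideal ideal_divide_of_nat harmonic2_bernoulli not_dvd) auto
  moreover have "S - (P + P ^ 3 / 2 * harmonic2 m) \<in> ideal 5"
    unfolding S_def P_def by (rule sum_T_4)
  ultimately have "S - (P + P ^ 3 / 2 * harmonic2 m)
      + P ^ 3 * ((harmonic2 m - 7 / 3 * P * B) / of_nat 2) \<in> ideal 5"
    by (intro ideal_add) simp_all
  also have "S - (P + P ^ 3 / 2 * harmonic2 m)
      + P ^ 3 * ((harmonic2 m - 7 / 3 * P * B) / of_nat 2) = S - (P + 7 / 6 * P ^ 4 * B)"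
    by (simp add: field_simps eval_nat_numeral)
  finally show "S - (of_nat p + 7 / 6 * of_nat p ^ 4 * bernoulli_number (p - 3)) \<in> ideal 5"
    unfolding P_def B_def .
  show "of_nat p + 7 / 6 * of_nat p ^ 4 * bernoulli_number (p - 3) \<in> ideal 0"
    by (intro ideal_add ideal_mult_left seven_sixths_in_ideal ideal_power of_nat_in_ideal
        bernoulli_in_ideal)
qed

text \<open>The alternating sum is known modulo p and enters with p^3/2, hence p^4. Its sign (-1)^m
  meets the one in the Euler congruence, and their product is 1.\<close>

lemma rat_cong_sum_T_minus_4:
  "rat_cong p 4 (\<Sum>k<p. of_nat (2 * k + 1) * (of_nat (T k) / (- 4) ^ k))
     ((- 1) ^ m * of_nat p + of_nat p ^ 3 * euler_number (p - 3))"
proof (rule rat_congI)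
  define E where "E = euler_number (p - 3)"
  define S where "S = (\<Sum>k<p. of_nat (2 * k + 1) * (rat_of_nat (T k) / (- 4) ^ k))"
  define P where "P = rat_of_nat p"
  define A where "A = (\<Sum>k=1..m. (- 1) ^ k / (rat_of_nat k)\<^sup>2)"
  define e where "e = (- 1 :: rat) ^ m"
  have e: "e * e = 1" by (simp add: e_def flip: power_add mult_2)
  have eI: "e \<in> ideal 0" unfolding e_def by (intro ideal_power ideal_uminus one_in_ideal)
  have "P ^ 3 * (e * (A - 2 * e * E) / of_nat 2) \<in> ideal (3 + 1)"
    unfolding P_def A_def E_def using gt3 eI alternating_harmonic2_euler[folded e_def]
    by (intro ideal_mult[of _ 3 _ 1] p_power_in_ideal ideal_divide_of_nat ideal_mult_left not_dvd) auto
  moreover have "S - (e * P + P ^ 3 / 2 * e * A) \<in> ideal 4"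
    unfolding S_def P_def e_def A_def by (rule sum_T_minus_4)
  ultimately have "S - (e * P + P ^ 3 / 2 * e * A) + P ^ 3 * (e * (A - 2 * e * E) / of_nat 2) \<in> ideal 4"
    by (intro ideal_add) simp_all
  also have "S - (e * P + P ^ 3 / 2 * e * A) + P ^ 3 * (e * (A - 2 * e * E) / of_nat 2)
      = S - (e * P + P ^ 3 * (e * e) * E)"
    by (simp add: field_simps)
  finally show "S - ((- 1) ^ m * of_nat p + of_nat p ^ 3 * euler_number (p - 3)) \<in> ideal 4"
    unfolding e P_def E_def e_def by simp
  show "(- 1) ^ m * of_nat p + of_nat p ^ 3 * euler_number (p - 3) \<in> ideal 0"
    by (intro ideal_add ideal_mult_left ideal_power ideal_uminus one_in_ideal of_nat_in_ideal
        euler_in_ideal)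
qed

end

end

theorem theorem1p2:
  fixes p :: nat
  assumes "prime p" and "p > 3"
  shows "rat_cong p 5
           (\<Sum>k=0..p-1. of_nat (2 * k + 1) * (of_nat (T k) / 4 ^ k))
           (of_nat p + 7 / 6 * of_nat p ^ 4 * bernoulli_number (p - 3)) \<and>
         rat_cong p 4
           (\<Sum>k=0..p-1. of_nat (2 * k + 1) * (of_nat (T k) / (-4) ^ k))
           ((-1) ^ ((p - 1) div 2) * of_nat p + of_nat p ^ 3 * euler_number (p - 3))"
proof -
  interpret localization p by standard (rule assms)
  have "odd p" using assms by (intro prime_odd_nat) auto
  then have p: "p = 2 * ((p - 1) div 2) + 1" by presburger
  have "{0..p - 1} = {..<p}" using assms by auto
  then show ?thesis
    using rat_cong_sum_T_4[OF p assms(2)] rat_cong_sum_T_minus_4[OF p assms(2)] by simp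
qed

end
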